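(* Let $M=\mathbb{Q}(i)$, so $\mathbb{Z}_M=\mathbb{Z}[i]$. Let $t$ be a positive integer with $t\le 100$ such that $t^2+4$ is square-free, let $\xi$ be a root of $f(x)=x^4-itx^2+1$ (which is irreducible over $M$), let $K=M(\xi)$ and let $\mathcal{O}=\mathbb{Z}_K$ be the ring of integers of $K$. Then, up to equivalence, the generators of relative power integral bases of $\mathcal{O}$ over $\mathbb{Z}[i]$ of the form $\alpha=x\xi+y\xi^2+z\xi^3$ with $x,y,z\in\mathbb{Z}[i]$ and $\max(|x|,|y|,|z|)\le 30$ are exactly \[ \alpha=\xi\quad\text{and}\quad\alpha=-it\xi+\xi^3 \] when $t\neq 1$; and when $t=1$ they are exactly these two together with \[ \alpha=3\xi+(1+i)\xi^2+2i\xi^3,\quad 3\xi-(1+i)\xi^2+2i\xi^3,\quad i\xi+(1+i)\xi^2+\xi^3,\quad i\xi-(1+i)\xi^2+\xi^3. \]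
   Context: An element $\alpha\in\mathcal{O}$ generates a relative power integral basis of $\mathcal{O}$ over $\mathbb{Z}[i]$ if $\mathcal{O}=\mathbb{Z}[i][\alpha]$, i.e. $1,\alpha,\alpha^2,\alpha^3$ is a $\mathbb{Z}[i]$-module basis of $\mathcal{O}$. Two elements of $\mathcal{O}$ are called equivalent if one is obtained from the other by multiplication by a unit and translation by an element of $\mathbb{Z}[i]$. Absolute values are complex absolute values.
   Formalization: For t>30 the listed element -itξ+ξ³ has |x|=t>30, outside the box, so "exactly" fails literally (e.g. t=31); proved instead: all listed elements are inequivalent generators whatever their size, and every generator in the box is equivalent to one of them. *)

theory Defs
  imports Complex_Main "HOL-Computational_Algebra.Computational_Algebra"
begin

definition is_subring :: "complex set \<Rightarrow> bool" where
  "is_subring S \<longleftrightarrow> 0 \<in> S \<and> 1 \<in> S \<and>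
     (\<forall>a\<in>S. \<forall>b\<in>S. a + b \<in> S \<and> a - b \<in> S \<and> a * b \<in> S)"

definition is_subfield :: "complex set \<Rightarrow> bool" where
  "is_subfield F \<longleftrightarrow> is_subring F \<and> (\<forall>a\<in>F. inverse a \<in> F)"

text \<open>The smallest subring (subfield) of the complex numbers containing a base ring (field)
  and a further element.\<close>

definition adjoin_ring :: "complex set \<Rightarrow> complex \<Rightarrow> complex set" where
  "adjoin_ring R a = is_subring hull (insert a R)"

definition adjoin_field :: "complex set \<Rightarrow> complex \<Rightarrow> complex set" where
  "adjoin_field F a = is_subfield hull (insert a F)"

definition gauss_rats :: "complex set" where
  "gauss_rats = adjoin_field \<rat> \<i>"

definition gauss_ints :: "complex set" where
  "gauss_ints = {of_int a + of_int b * \<i> | a b. True}"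

definition ring_of_integers :: "complex set \<Rightarrow> complex set" where
  "ring_of_integers K = {a \<in> K. algebraic_int a}"

definition irreducible_over :: "complex set \<Rightarrow> complex poly \<Rightarrow> bool" where
  "irreducible_over F p \<longleftrightarrow> set (coeffs p) \<subseteq> F \<and> degree p > 0 \<and>
     (\<forall>g h. set (coeffs g) \<subseteq> F \<longrightarrow> set (coeffs h) \<subseteq> F \<longrightarrow> p = g * h \<longrightarrow>
        degree g = 0 \<or> degree h = 0)"

definition quartic :: "nat \<Rightarrow> complex poly" where
  "quartic t = [:1, 0, - (\<i> * of_nat t), 0, 1:]"

text \<open>\<open>a\<close> generates a relative power integral basis of \<open>R\<close> over the Gaussian integers.\<close>

definition generates_rel_pib :: "complex set \<Rightarrow> complex \<Rightarrow> bool" where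
  "generates_rel_pib R a \<longleftrightarrow> R = adjoin_ring gauss_ints a"

text \<open>The units are those of the base ring, not those of the order: for a root \<open>\<xi>\<close> of the
  quartic, \<open>\<xi>\<close> is itself a unit of the order, and multiplication by units of the order
  does not preserve the generators of relative power integral bases.\<close>

definition gauss_units :: "complex set" where
  "gauss_units = {u \<in> gauss_ints. \<exists>v\<in>gauss_ints. u * v = 1}"

definition rel_equivalent :: "complex \<Rightarrow> complex \<Rightarrow> bool" where
  "rel_equivalent a b \<longleftrightarrow> (\<exists>u\<in>gauss_units. \<exists>c\<in>gauss_ints. a = u * b + c)"

end

theory Submission
  imports Defs "Jordan_Normal_Form.Char_Poly"
begin

text \<open>The conjugates of \<open>\<xi>\<close> over \<open>\<rat>(\<i>)\<close> are \<open>\<plusminus>\<xi>\<close> and \<open>\<plusminus>1/\<xi>\<close>, and \<open>\<xi>\<^sup>2 + 1/\<xi>\<^sup>2 = \<i>t\<close>; all of them lie in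
  \<open>\<int>[\<i>][\<xi>]\<close>, which turns out to be the full ring of integers. Hence the index form of
  \<open>x\<xi> + y\<xi>\<^sup>2 + z\<xi>\<^sup>3\<close> splits over \<open>\<int>[\<i>]\<close> into three factors, each of which has to be a unit. Two of
  them differ by \<open>4(zw - y\<^sup>2)\<close>, where \<open>w = x + \<i>tz\<close>; as units are too small to differ by a nonzero
  multiple of 4, this gives \<open>y\<^sup>2 = zw\<close>. The third factor is \<open>w\<^sup>2 - \<i>t wz + z\<^sup>2\<close>, so the pair
  \<open>(w, -\<i>z)\<close> solves a Pell equation over \<open>\<int>[\<i>]\<close>, whose solutions are unit multiples of rational
  integer solutions \<open>(W, S)\<close>. Finally \<open>y\<^sup>2 = zw\<close> forces \<open>\<bar>WS\<bar>\<close> to be twice a square, and bounding \<open>y\<close>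
  leaves a finite search.\<close>

section \<open>Sums and products of algebraic integers\<close>

text \<open>Once \<open>y\<^sup>2 = z * w\<close> holds, all three factors of the index form equal
  \<open>w\<^sup>2 - s * w * z + z\<^sup>2\<close> with s = \<i>t; this is why a single Pell
  equation remains. The squarefree number t^2 + 4 enters in three guises. It is not a rational
  square, whence the independence of 1, X, X^2, X^3 over Q(i) for each root X, irreducibility, and
  the anisotropy of the Pell form. Up to sign it is the discriminant of the step from Q(i) to
  Q(i)(\<xi>^2); being odd it stays squarefree in Z[i], so the integers of that step are
  Z[i][\<xi>^2]. Finally it forces t to be odd, which decides divisibility by 1 + \<i> in the
  remaining step. Conjugation is nothing but a change of argument in a polynomial with fixed
  coefficients: the powers of every root are independent, so no field automorphism has to be
  constructed. In the final search t is not a variable; it is recovered as a quotient from W and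
  \<open>S - t * W\<close>.\<close>

definition int_span :: "'i set \<Rightarrow> ('i \<Rightarrow> complex) \<Rightarrow> complex set" where
  "int_span I w = {\<Sum>i\<in>I. of_int (c i) * w i | c. True}"

lemma int_span_zero: "0 \<in> int_span I w"
  unfolding int_span_def by (rule CollectI, rule exI[of _ "\<lambda>_. 0"]) simp

lemma int_span_add:
  assumes "x \<in> int_span I w" "y \<in> int_span I w"
  shows "x + y \<in> int_span I w"
proof -
  from assms obtain c d where "x = (\<Sum>i\<in>I. of_int (c i) * w i)" "y = (\<Sum>i\<in>I. of_int (d i) * w i)"
    unfolding int_span_def by blast
  then have "x + y = (\<Sum>i\<in>I. of_int (c i + d i) * w i)"
    by (simp add: sum.distrib algebra_simps)
  then show ?thesis unfolding int_span_def by (auto intro!: exI[of _ "\<lambda>i. c i + d i"])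
qed

lemma int_span_scale:
  assumes "x \<in> int_span I w"
  shows "of_int k * x \<in> int_span I w"
proof -
  from assms obtain c where "x = (\<Sum>i\<in>I. of_int (c i) * w i)"
    unfolding int_span_def by blast
  then have "of_int k * x = (\<Sum>i\<in>I. of_int (k * c i) * w i)"
    by (simp add: sum_distrib_left algebra_simps)
  then show ?thesis unfolding int_span_def by (auto intro!: exI[of _ "\<lambda>i. k * c i"])
qed

lemma int_span_sum:
  assumes "\<And>j. j \<in> J \<Longrightarrow> f j \<in> int_span I w"
  shows "sum f J \<in> int_span I w"
  using assms by (induction J rule: infinite_finite_induct) (auto intro: int_span_zero int_span_add)

lemma int_span_base:
  assumes "finite I" "i \<in> I"
  shows "w i \<in> int_span I w"
proof -
  have "w i = (\<Sum>j\<in>I. of_int (if j = i then 1 else 0) * w j)"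
    using assms by (simp add: if_distrib[of "\<lambda>x. of_int x * _"] sum.delta' cong: if_cong)
  then show ?thesis unfolding int_span_def by (auto intro!: exI[of _ "\<lambda>j. if j = i then 1 else 0"])
qed

lemma int_span_mult_closed:
  assumes "\<And>i. i \<in> I \<Longrightarrow> a * w i \<in> int_span I w" and "x \<in> int_span I w"
  shows "a * x \<in> int_span I w"
proof -
  from assms(2) obtain c where "x = (\<Sum>i\<in>I. of_int (c i) * w i)"
    unfolding int_span_def by blast
  then have "a * x = (\<Sum>i\<in>I. of_int (c i) * (a * w i))"
    by (simp add: sum_distrib_left algebra_simps)
  then show ?thesis using assms(1) by (auto intro: int_span_sum int_span_scale)
qed

text \<open>The determinant trick: stability makes the vector of the \<open>w i\<close> an
  eigenvector of an integer matrix with eigenvalue \<open>v\<close>, so \<open>v\<close> is a root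
  of a monic integer characteristic polynomial. The \<open>w i\<close> may be dependent; one nonzero
  entry suffices for an eigenvector.\<close>

lemma algebraic_int_int_span:
  fixes I :: "'i set"
  assumes fin: "finite I" and i0: "i0 \<in> I" "w i0 \<noteq> 0"
    and stable: "\<And>i. i \<in> I \<Longrightarrow> v * w i \<in> int_span I w"
  shows "algebraic_int v"
proof -
  obtain h where h: "bij_betw h {0..<card I} I"
    using ex_bij_betw_nat_finite[OF fin] by blast
  define n where "n = card I"
  have "\<forall>i\<in>I. \<exists>c. v * w i = (\<Sum>j\<in>I. of_int (c j) * w j)"
    using stable unfolding int_span_def by blast
  then obtain M where M: "\<And>i. i \<in> I \<Longrightarrow> v * w i = (\<Sum>j\<in>I. of_int (M i j) * w j)"
    by metis
  define A :: "int mat" where "A = mat n n (\<lambda>(i, j). M (h i) (h j))"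
  define u where "u = vec n (\<lambda>i. w (h i))"
  have A: "A \<in> carrier_mat n n" by (simp add: A_def)
  have A': "map_mat complex_of_int A \<in> carrier_mat n n" using A by simp
  obtain k0 where k0: "k0 < n" "h k0 = i0"
    using h i0(1) unfolding bij_betw_def n_def by (metis atLeastLessThan_iff imageE)
  have "eigenvector (map_mat complex_of_int A) u v"
    unfolding eigenvector_def
  proof (intro conjI)
    show "u \<in> carrier_vec (dim_row (map_mat complex_of_int A))" by (simp add: u_def A_def)
    have "u $ k0 \<noteq> 0" using k0 i0 by (simp add: u_def)
    then show "u \<noteq> 0\<^sub>v (dim_row (map_mat complex_of_int A))"
      using k0 by (auto simp: A_def)
    show "map_mat complex_of_int A *\<^sub>v u = v \<cdot>\<^sub>v u"
    proof (rule eq_vecI)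
      fix i assume "i < dim_vec (v \<cdot>\<^sub>v u)"
      then have i: "i < n" by (simp add: u_def)
      have hi: "h i \<in> I" using h i unfolding bij_betw_def n_def by auto
      have "(map_mat complex_of_int A *\<^sub>v u) $ i
          = (\<Sum>j\<in>{0..<n}. of_int (M (h i) (h j)) * w (h j))"
        using i by (simp add: A_def u_def scalar_prod_def)
      also have "\<dots> = (\<Sum>j\<in>I. of_int (M (h i) j) * w j)"
        using h unfolding n_def by (rule sum.reindex_bij_betw)
      also have "\<dots> = v * w (h i)" using M[OF hi] by simp
      finally show "(map_mat complex_of_int A *\<^sub>v u) $ i = (v \<cdot>\<^sub>v u) $ i"
        using i by (simp add: u_def)
    qed (simp add: A_def u_def)
  qed
  then have "eigenvalue (map_mat complex_of_int A) v"
    unfolding eigenvalue_def by blast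
  then have "poly (char_poly (map_mat complex_of_int A)) v = 0"
    using eigenvalue_root_char_poly[OF A'] by simp
  then have "poly (map_poly of_int (char_poly A)) v = 0"
    by (simp add: of_int_hom.char_poly_hom[OF A])
  moreover have "lead_coeff (char_poly A) = 1"
    using degree_monic_char_poly[OF A] by simp
  ultimately show ?thesis unfolding algebraic_int_altdef_ipoly by blast
qed

lemma algebraic_int_power_relation:
  fixes a :: complex
  assumes "algebraic_int a"
  obtains n c where "n > 0" "a ^ n = (\<Sum>k<n. of_int (c k) * a ^ k)"
proof -
  obtain p where p: "poly (map_poly of_int p) a = 0" "lead_coeff p = 1"
    using assms unfolding algebraic_int_altdef_ipoly by blast
  define n where "n = degree p"
  have deg: "degree (map_poly complex_of_int p) = n" by (simp add: n_def degree_map_poly)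
  have "0 = (\<Sum>k\<le>n. of_int (coeff p k) * a ^ k)"
    using p(1) by (simp add: poly_altdef deg coeff_map_poly n_def)
  also have "\<dots> = (\<Sum>k<n. of_int (coeff p k) * a ^ k) + a ^ n"
    using p(2) by (simp add: n_def lessThan_Suc_atMost[symmetric])
  finally have eq: "a ^ n = (\<Sum>k<n. of_int (- coeff p k) * a ^ k)"
    by (simp add: sum_negf eq_neg_iff_add_eq_0 add.commute)
  moreover have "n > 0"
  proof (rule ccontr)
    assume "\<not> n > 0"
    then show False using eq by simp
  qed
  ultimately show ?thesis by (rule that[rotated])
qed

text \<open>The products \<open>a ^ i * b ^ j\<close> with exponents below the degrees of two monic
  relations span a module stable under both numbers, hence under their sum and product. The
  generator 1 supplies the nonzero entry of the eigenvector.\<close>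

lemma algebraic_int_common_module:
  fixes a b :: complex
  assumes "algebraic_int a" "algebraic_int b"
  obtains I :: "(nat \<times> nat) set" and w where "finite I" "(0, 0) \<in> I" "w (0, 0) = 1"
    "\<And>i. i \<in> I \<Longrightarrow> a * w i \<in> int_span I w" "\<And>i. i \<in> I \<Longrightarrow> b * w i \<in> int_span I w"
proof -
  obtain m c where m: "m > 0" "a ^ m = (\<Sum>k<m. of_int (c k) * a ^ k)"
    using algebraic_int_power_relation[OF assms(1)] by blast
  obtain n d where n: "n > 0" "b ^ n = (\<Sum>k<n. of_int (d k) * b ^ k)"
    using algebraic_int_power_relation[OF assms(2)] by blast
  define I where "I = {..<m} \<times> {..<n}"
  define w where "w = (\<lambda>(i, j). a ^ i * b ^ j)"
  have fin: "finite I" by (simp add: I_def)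
  have base: "a ^ i * b ^ j \<in> int_span I w" if "i < m" "j < n" for i j
    using int_span_base[OF fin, of "(i, j)" w] that by (simp add: I_def w_def)
  have "a * w ij \<in> int_span I w" if ij: "ij \<in> I" for ij
  proof -
    obtain i j where [simp]: "ij = (i, j)" and "i < m" "j < n" using ij by (auto simp: I_def)
    have eq: "a * w ij = a ^ Suc i * b ^ j" by (simp add: w_def)
    show ?thesis
    proof (cases "Suc i < m")
      case True
      then show ?thesis unfolding eq using \<open>j < n\<close> by (rule base)
    next
      case False
      then have "Suc i = m" using \<open>i < m\<close> by simp
      then have "a * w ij = (\<Sum>k<m. of_int (c k) * (a ^ k * b ^ j))"
        unfolding eq using m(2) by (simp add: sum_distrib_right mult.assoc)
      then show ?thesis using \<open>j < n\<close> by (auto intro!: int_span_sum int_span_scale base)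
    qed
  qed
  moreover have "b * w ij \<in> int_span I w" if ij: "ij \<in> I" for ij
  proof -
    obtain i j where [simp]: "ij = (i, j)" and "i < m" "j < n" using ij by (auto simp: I_def)
    have eq: "b * w ij = a ^ i * b ^ Suc j" by (simp add: w_def)
    show ?thesis
    proof (cases "Suc j < n")
      case True
      show ?thesis unfolding eq using \<open>i < m\<close> True by (rule base)
    next
      case False
      then have "Suc j = n" using \<open>j < n\<close> by simp
      then have "b * w ij = (\<Sum>k<n. of_int (d k) * (a ^ i * b ^ k))"
        unfolding eq using n(2) by (simp add: sum_distrib_left mult.left_commute)
      then show ?thesis using \<open>i < m\<close> by (auto intro!: int_span_sum int_span_scale base)
    qed
  qed
  moreover have "(0, 0) \<in> I" "w (0, 0) = 1" using m(1) n(1) by (simp_all add: I_def w_def)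
  ultimately show ?thesis using fin that by blast
qed

lemma algebraic_int_add [intro]:
  fixes a b :: complex
  assumes "algebraic_int a" "algebraic_int b"
  shows "algebraic_int (a + b)"
  using assms
proof (rule algebraic_int_common_module)
  fix I :: "(nat \<times> nat) set" and w
  assume *: "finite I" "(0, 0) \<in> I" "w (0, 0) = 1"
    "\<And>i. i \<in> I \<Longrightarrow> a * w i \<in> int_span I w" "\<And>i. i \<in> I \<Longrightarrow> b * w i \<in> int_span I w"
  show ?thesis
    by (rule algebraic_int_int_span[of I "(0, 0)" w]) (use * in \<open>auto simp: distrib_right intro: int_span_add\<close>)
qed

lemma algebraic_int_mult [intro]:
  fixes a b :: complex
  assumes "algebraic_int a" "algebraic_int b"
  shows "algebraic_int (a * b)"
  using assms
proof (rule algebraic_int_common_module)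
  fix I :: "(nat \<times> nat) set" and w
  assume *: "finite I" "(0, 0) \<in> I" "w (0, 0) = 1"
    "\<And>i. i \<in> I \<Longrightarrow> a * w i \<in> int_span I w" "\<And>i. i \<in> I \<Longrightarrow> b * w i \<in> int_span I w"
  show ?thesis
    by (rule algebraic_int_int_span[of I "(0, 0)" w])
       (use * in \<open>auto simp: mult.assoc intro: int_span_mult_closed\<close>)
qed

lemma algebraic_int_diff [intro]:
  fixes a b :: complex
  assumes "algebraic_int a" "algebraic_int b"
  shows "algebraic_int (a - b)"
  using algebraic_int_add[OF assms(1) algebraic_int_minus[OF assms(2)]] by simp

lemma algebraic_int_power [intro]:
  fixes a :: complex
  assumes "algebraic_int a"
  shows "algebraic_int (a ^ n)"
  using assms by (induction n) auto

lemmas algebraic_int_closed = algebraic_int_add algebraic_int_diff algebraic_int_mult algebraic_int_power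

section \<open>Gaussian integers and rationals\<close>

lemma gauss_ints_iff: "z \<in> gauss_ints \<longleftrightarrow> Re z \<in> \<int> \<and> Im z \<in> \<int>"
proof
  assume "Re z \<in> \<int> \<and> Im z \<in> \<int>"
  then obtain a b where "Re z = of_int a" "Im z = of_int b" by (auto elim!: Ints_cases)
  then have "z = of_int a + of_int b * \<i>" by (simp add: complex_eq_iff)
  then show "z \<in> gauss_ints" unfolding gauss_ints_def by blast
qed (auto simp: gauss_ints_def)

lemma gauss_ints_add [intro]: "a \<in> gauss_ints \<Longrightarrow> b \<in> gauss_ints \<Longrightarrow> a + b \<in> gauss_ints"
  and gauss_ints_diff [intro]: "a \<in> gauss_ints \<Longrightarrow> b \<in> gauss_ints \<Longrightarrow> a - b \<in> gauss_ints"
  and gauss_ints_mult [intro]: "a \<in> gauss_ints \<Longrightarrow> b \<in> gauss_ints \<Longrightarrow> a * b \<in> gauss_ints"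
  and gauss_ints_minus [intro]: "a \<in> gauss_ints \<Longrightarrow> - a \<in> gauss_ints"
  and gauss_ints_of_int [simp, intro]: "of_int k \<in> gauss_ints"
  and gauss_ints_of_nat [simp, intro]: "of_nat n \<in> gauss_ints"
  and gauss_ints_numeral [simp, intro]: "numeral w \<in> gauss_ints"
  and gauss_ints_zero [simp, intro]: "0 \<in> gauss_ints"
  and gauss_ints_one [simp, intro]: "1 \<in> gauss_ints"
  and gauss_ints_ii [simp, intro]: "\<i> \<in> gauss_ints"
  by (auto simp: gauss_ints_iff)

lemma gauss_ints_power [intro]: "a \<in> gauss_ints \<Longrightarrow> a ^ n \<in> gauss_ints"
  by (induction n) auto

lemma gauss_rats_iff: "z \<in> gauss_rats \<longleftrightarrow> Re z \<in> \<rat> \<and> Im z \<in> \<rat>"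
proof -
  define Q where "Q = {z. Re z \<in> \<rat> \<and> Im z \<in> \<rat>}"
  have rat: "r \<in> \<rat> \<Longrightarrow> r \<in> Q" for r :: complex
  proof -
    assume "r \<in> \<rat>"
    then obtain q where "r = of_rat q" by (rule Rats_cases)
    moreover have "complex_of_real (of_rat q) = of_rat q"
      by (cases q) (simp add: of_rat_rat)
    ultimately have "r = complex_of_real (of_rat q)" by simp
    then show ?thesis by (simp add: Q_def)
  qed
  have inv: "inverse a \<in> Q" if "a \<in> Q" for a
    using that by (auto simp: Q_def complex_inverse intro!: Rats_divide Rats_add Rats_power)
  have "is_subfield Q"
    unfolding is_subfield_def is_subring_def using inv by (auto simp: Q_def)
  moreover have "insert \<i> \<rat> \<subseteq> Q" using rat by (auto simp: Q_def)
  ultimately have "gauss_rats \<subseteq> Q"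
    unfolding gauss_rats_def adjoin_field_def by (intro hull_minimal)
  moreover have "Q \<subseteq> gauss_rats"
  proof
    fix z assume "z \<in> Q"
    then obtain a b where ab: "Re z = of_rat a" "Im z = of_rat b"
      by (auto simp: Q_def elim!: Rats_cases)
    have "complex_of_rat q = of_real (of_rat q)" for q
      by (cases q) (simp add: of_rat_rat)
    then have "z = of_rat a + of_rat b * \<i>" using ab by (simp add: complex_eq_iff)
    moreover have "of_rat a + of_rat b * \<i> \<in> F" if F: "is_subfield F" "insert \<i> \<rat> \<subseteq> F" for F
    proof -
      have "of_rat a \<in> F" "of_rat b \<in> F" "\<i> \<in> F" using F(2) by auto
      then show ?thesis using F(1) unfolding is_subfield_def is_subring_def by blast
    qed
    ultimately show "z \<in> gauss_rats"
      unfolding gauss_rats_def adjoin_field_def hull_def by blast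
  qed
  ultimately show ?thesis by (auto simp: Q_def)
qed

lemma gauss_rats_add [intro]: "a \<in> gauss_rats \<Longrightarrow> b \<in> gauss_rats \<Longrightarrow> a + b \<in> gauss_rats"
  and gauss_rats_diff [intro]: "a \<in> gauss_rats \<Longrightarrow> b \<in> gauss_rats \<Longrightarrow> a - b \<in> gauss_rats"
  and gauss_rats_mult [intro]: "a \<in> gauss_rats \<Longrightarrow> b \<in> gauss_rats \<Longrightarrow> a * b \<in> gauss_rats"
  and gauss_rats_minus [intro]: "a \<in> gauss_rats \<Longrightarrow> - a \<in> gauss_rats"
  and gauss_rats_of_int [simp, intro]: "of_int k \<in> gauss_rats"
  and gauss_rats_of_nat [simp, intro]: "of_nat n \<in> gauss_rats"
  and gauss_rats_numeral [simp, intro]: "numeral w \<in> gauss_rats"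
  and gauss_rats_zero [simp, intro]: "0 \<in> gauss_rats"
  and gauss_rats_one [simp, intro]: "1 \<in> gauss_rats"
  and gauss_rats_ii [simp, intro]: "\<i> \<in> gauss_rats"
  by (auto simp: gauss_rats_iff)

lemma gauss_rats_inverse [intro]: "a \<in> gauss_rats \<Longrightarrow> inverse a \<in> gauss_rats"
  by (auto simp: gauss_rats_iff complex_inverse intro!: Rats_divide Rats_add Rats_power)

lemma gauss_rats_divide [intro]: "a \<in> gauss_rats \<Longrightarrow> b \<in> gauss_rats \<Longrightarrow> a / b \<in> gauss_rats"
  unfolding divide_inverse by auto

lemma gauss_rats_power [intro]: "a \<in> gauss_rats \<Longrightarrow> a ^ n \<in> gauss_rats"
  by (induction n) auto

lemma gauss_ints_imp_rats: "a \<in> gauss_ints \<Longrightarrow> a \<in> gauss_rats"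
  by (auto simp: gauss_rats_iff gauss_ints_iff elim!: Ints_cases)

lemma gauss_ints_algebraic_int:
  assumes "a \<in> gauss_ints"
  shows "algebraic_int a"
  using assms by (auto simp: gauss_ints_def)

text \<open>The traces of \<open>z\<close> and \<open>- \<i> * z\<close> and the norm of
  \<open>z\<close> are rational algebraic integers. So only a denominator 2 is possible in each
  part, and it disappears because two squares whose sum is divisible by 4 are both even.\<close>

lemma gauss_rats_algebraic_int:
  assumes "z \<in> gauss_rats" and z: "algebraic_int z"
  shows "z \<in> gauss_ints"
proof -
  have rat: "Re z \<in> \<rat>" "Im z \<in> \<rat>" using assms(1) by (auto simp: gauss_rats_iff)
  have "algebraic_int (cnj z)" using z by simp
  then have "algebraic_int (z + cnj z)" "algebraic_int (- (\<i> * (z - cnj z)))" "algebraic_int (z * cnj z)"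
    using z by auto
  moreover have "z + cnj z = of_real (2 * Re z)" "- (\<i> * (z - cnj z)) = of_real (2 * Im z)"
    "z * cnj z = of_real ((Re z)\<^sup>2 + (Im z)\<^sup>2)"
    by (simp_all add: complex_eq_iff power2_eq_square algebra_simps)
  ultimately have "algebraic_int (2 * Re z)" "algebraic_int (2 * Im z)"
    "algebraic_int ((Re z)\<^sup>2 + (Im z)\<^sup>2)"
    by (simp_all only: algebraic_int_of_real_iff)
  then have "2 * Re z \<in> \<int>" "2 * Im z \<in> \<int>" "(Re z)\<^sup>2 + (Im z)\<^sup>2 \<in> \<int>"
    using rat by (auto intro!: rational_algebraic_int_is_int Rats_add Rats_power)
  then obtain A B N where AB: "2 * Re z = of_int A" "2 * Im z = of_int B"
    "(Re z)\<^sup>2 + (Im z)\<^sup>2 = of_int N"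
    by (auto elim!: Ints_cases)
  have "of_int (A\<^sup>2 + B\<^sup>2) = (of_int (4 * N) :: real)"
    unfolding of_int_add of_int_mult of_int_power AB(1)[symmetric] AB(2)[symmetric] AB(3)[symmetric]
    by (simp add: power2_eq_square algebra_simps)
  then have sum: "A\<^sup>2 + B\<^sup>2 = 4 * N" by (simp only: of_int_eq_iff)
  have sq: "x\<^sup>2 mod 4 = (if even x then 0 else 1)" for x :: int
  proof (cases "even x")
    case True
    then show ?thesis by (auto simp: power2_eq_square)
  next
    case False
    then obtain k where "x = 2 * k + 1" by (auto elim!: oddE)
    then have "x\<^sup>2 = 1 + (k\<^sup>2 + k) * 4" by (simp add: power2_eq_square algebra_simps)
    then have "x\<^sup>2 mod 4 = 1" by (simp only: mod_mult_self1) simp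
    then show ?thesis using False by simp
  qed
  have "(A\<^sup>2 mod 4 + B\<^sup>2 mod 4) mod 4 = 0" using sum by (simp add: mod_add_eq)
  then have "even A" "even B" unfolding sq by (auto split: if_splits)
  then obtain a b where "A = 2 * a" "B = 2 * b" by (auto elim!: evenE)
  then have "Re z = of_int a" "Im z = of_int b" using AB by auto
  then show ?thesis by (simp add: gauss_ints_iff)
qed

lemma gauss_units_eq: "gauss_units = {1, -1, \<i>, -\<i>}"
proof -
  have "u \<in> {1, -1, \<i>, -\<i>}" if uv: "u \<in> gauss_ints" "v \<in> gauss_ints" "u * v = 1" for u v
  proof -
    obtain a b where u: "u = of_int a + of_int b * \<i>" using uv(1) unfolding gauss_ints_def by blast
    obtain c d where v: "v = of_int c + of_int d * \<i>" using uv(2) unfolding gauss_ints_def by blast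
    have "(cmod u)\<^sup>2 * (cmod v)\<^sup>2 = 1"
      using uv(3) by (metis norm_mult norm_one power_mult_distrib power_one)
    moreover have "(cmod u)\<^sup>2 = of_int (a\<^sup>2 + b\<^sup>2)" "(cmod v)\<^sup>2 = of_int (c\<^sup>2 + d\<^sup>2)"
      by (simp_all add: u v cmod_power2)
    ultimately have "of_int ((a\<^sup>2 + b\<^sup>2) * (c\<^sup>2 + d\<^sup>2)) = (of_int 1 :: real)" by simp
    then have "(a\<^sup>2 + b\<^sup>2) * (c\<^sup>2 + d\<^sup>2) = 1" by (simp only: of_int_eq_iff)
    then have "a\<^sup>2 + b\<^sup>2 dvd 1" by (rule dvdI[OF sym])
    then have s: "a\<^sup>2 + b\<^sup>2 = 1" by simp
    have "a\<^sup>2 \<le> 1" "b\<^sup>2 \<le> 1"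
      using s zero_le_power2[of a] zero_le_power2[of b] by linarith+
    then have "\<bar>a\<bar> \<le> 1" "\<bar>b\<bar> \<le> 1" by (simp_all add: abs_square_le_1)
    then have "a \<in> {-1, 0, 1}" "b \<in> {-1, 0, 1}" by auto
    then show ?thesis using s by (auto simp: u)
  qed
  then have "gauss_units \<subseteq> {1, -1, \<i>, -\<i>}" unfolding gauss_units_def by blast
  moreover have "{1, -1, \<i>, -\<i>} \<subseteq> gauss_units"
  proof -
    have "\<exists>v\<in>gauss_ints. - v = 1" "\<exists>v\<in>gauss_ints. \<i> * v = 1"
      by (rule bexI[of _ "-1"] bexI[of _ "-\<i>"]; auto)+
    then show ?thesis unfolding gauss_units_def by (auto intro: bexI[of _ \<i>])
  qed
  ultimately show ?thesis by blast
qed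

section \<open>Squarefree integers and denominators in Q(i)\<close>

lemma squarefree_prime_square_dvd:
  fixes D :: nat and m p :: int
  assumes "squarefree D" "prime p" "p\<^sup>2 dvd int D * m"
  shows "p dvd m"
proof (rule ccontr)
  assume "\<not> p dvd m"
  then have "coprime (p\<^sup>2) m" using assms(2) by (simp add: prime_imp_coprime)
  then have "p\<^sup>2 dvd int D" using assms(3) by (simp add: coprime_dvd_mult_left_iff)
  then have "(nat p)\<^sup>2 dvd D"
    using assms(2) by (metis int_nat_eq nat_int nat_power_eq prime_ge_0_int nat_dvd_iff zero_le_power2 of_nat_dvd_iff of_nat_power)
  then have "nat p dvd 1" using assms(1) by (rule squarefreeD[rotated])
  then show False using assms(2) prime_gt_1_int[of p] by simp
qed

text \<open>An odd squarefree integer has no square factor in Z[i] other than units, so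
  \<open>D\<close> cannot absorb the denominator of \<open>g\<^sup>2\<close>. Oddness matters: for D
  = 2 and g = 1/(1 + \<i>) the product is -\<i>.\<close>

lemma gauss_rats_square_sqfree:
  fixes D :: nat
  assumes g: "g \<in> gauss_rats" and D: "squarefree D" "odd D"
    and int: "g\<^sup>2 * of_nat D \<in> gauss_ints"
  shows "g \<in> gauss_ints"
proof -
  define P where "P = (\<lambda>n::nat. n > 0 \<and> of_nat n * g \<in> gauss_ints)"
  have "\<exists>n. P n"
  proof -
    have "Re g \<in> \<rat>" "Im g \<in> \<rat>" using g by (auto simp: gauss_rats_iff)
    then obtain a b c d where *: "Re g = of_int a / of_int b" "b > 0" "Im g = of_int c / of_int d" "d > 0"
      by (meson Rats_cases')
    have "real (nat (b * d)) = of_int b * of_int d" using * by simp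
    then have "real (nat (b * d)) * Re g = of_int (a * d)" "real (nat (b * d)) * Im g = of_int (b * c)"
      using * by simp_all
    then have "of_nat (nat (b * d)) * g \<in> gauss_ints" unfolding gauss_ints_iff by (simp del: of_nat_nat)
    then show ?thesis unfolding P_def using * by (intro exI[of _ "nat (b * d)"]) simp
  qed
  define n where "n = (LEAST n. P n)"
  have n: "P n" unfolding n_def using \<open>\<exists>n. P n\<close> by (rule LeastI_ex)
  have least: "n \<le> m" if "P m" for m unfolding n_def using that by (rule Least_le)
  have "n = 1"
  proof (rule ccontr)
    assume "n \<noteq> 1"
    then obtain q where q: "prime q" "q dvd n" by (metis prime_factor_nat)
    then obtain k where k: "n = q * k" by auto
    define p where "p = int q"
    have p: "prime p" "p > 1" using q(1) prime_gt_1_nat[OF q(1)] by (simp_all add: p_def)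
    have "Re (of_nat n * g) \<in> \<int>" "Im (of_nat n * g) \<in> \<int>" using n by (auto simp: P_def gauss_ints_iff)
    then obtain A B where AB: "real n * Re g = of_int A" "real n * Im g = of_int B"
      by (auto elim!: Ints_cases)
    have "Re (g\<^sup>2 * of_nat D) \<in> \<int>" "Im (g\<^sup>2 * of_nat D) \<in> \<int>" using int by (auto simp: gauss_ints_iff)
    then obtain U V where UV: "((Re g)\<^sup>2 - (Im g)\<^sup>2) * real D = of_int U" "2 * Re g * Im g * real D = of_int V"
      by (auto elim!: Ints_cases simp: Re_power2 Im_power2)
    have "of_int (int D * (A\<^sup>2 - B\<^sup>2)) = (of_int ((int n)\<^sup>2 * U) :: real)"
      unfolding of_int_mult of_int_power of_int_diff AB[symmetric] UV[symmetric]
      by (simp add: power2_eq_square algebra_simps)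
    then have e1: "int D * (A\<^sup>2 - B\<^sup>2) = (int n)\<^sup>2 * U" by (simp only: of_int_eq_iff)
    have "of_int (int D * (2 * A * B)) = (of_int ((int n)\<^sup>2 * V) :: real)"
      unfolding of_int_mult of_int_power of_int_diff AB[symmetric] UV[symmetric]
      by (simp add: power2_eq_square algebra_simps)
    then have e2: "int D * (2 * A * B) = (int n)\<^sup>2 * V" by (simp only: of_int_eq_iff)
    have pn: "p\<^sup>2 dvd (int n)\<^sup>2" using k by (simp add: p_def)
    \<comment> \<open>A prime dividing the least denominator and both numerators could be cancelled,
      against minimality. For p = 2 the factor 2 in \<open>2 * A * B\<close> costs one power of 2;
      since \<open>D\<close> is odd, the full factor 4 is available to pay for it.\<close>
    have "p dvd A \<and> p dvd B"
    proof (cases "p = 2")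
      case False
      have "p\<^sup>2 dvd int D * (A\<^sup>2 - B\<^sup>2)" "p\<^sup>2 dvd int D * (2 * A * B)"
        unfolding e1 e2 using pn by auto
      then have d: "p dvd A\<^sup>2 - B\<^sup>2" "p dvd 2 * A * B"
        using squarefree_prime_square_dvd[OF D(1) p(1)] by blast+
      have "\<not> p dvd 2" using False p primes_dvd_imp_eq[of p 2] by auto
      then have "p dvd A \<or> p dvd B" using d(2) p(1) by (simp add: prime_dvd_mult_iff)
      then have "p dvd A\<^sup>2 \<and> p dvd B\<^sup>2"
      proof
        assume "p dvd A"
        then have "p dvd A\<^sup>2" by (simp add: power2_eq_square)
        then show ?thesis using d(1) by (metis dvd_diff_right_iff dvd_diff_commute dvd_minus_iff)
      next
        assume "p dvd B"
        then have "p dvd B\<^sup>2" by (simp add: power2_eq_square)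
        then show ?thesis using d(1) by (metis dvd_diff_left_iff)
      qed
      then show ?thesis using p(1) prime_dvd_power by blast
    next
      case True
      have four: "(4::int) dvd (int n)\<^sup>2" using pn True by simp
      have cop: "coprime 4 (int D)"
        using D(2) by (metis coprime_left_2_iff_odd coprime_power_left_iff even_of_nat_iff numeral_eq_Suc
            power2_eq_square mult_2_right numeral_Bit0 one_add_one coprime_mult_left_iff)
      have "4 dvd A\<^sup>2 - B\<^sup>2" "4 dvd 2 * (A * B)"
        using e1 e2 four cop by (metis coprime_dvd_mult_right_iff dvd_mult2 mult.assoc)+
      then obtain k l where "A\<^sup>2 - B\<^sup>2 = 4 * k" "2 * (A * B) = 4 * l" by (elim dvdE)
      then have "A\<^sup>2 - B\<^sup>2 = 2 * (2 * k)" "A * B = 2 * l" by linarith+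
      then have "even (A\<^sup>2 - B\<^sup>2)" "even (A * B)" by simp_all
      then show ?thesis using True by auto
    qed
    then obtain A' B' where A'B': "A = p * A'" "B = p * B'" by (auto elim!: dvdE)
    have "real k * Re g = of_int A'" "real k * Im g = of_int B'"
      using AB A'B' p(2) by (auto simp: k p_def mult.assoc)
    then have "P k" using n unfolding P_def gauss_ints_iff by (simp add: k)
    then have "n \<le> k" by (rule least)
    moreover have "k > 0" using n by (simp add: P_def k)
    ultimately show False using p(2) by (simp add: k p_def)
  qed
  then show ?thesis using n by (simp add: P_def)
qed

lemma squarefree_not_rat_square:
  fixes D :: nat and r :: real
  assumes "squarefree D" "D > 1" "r \<in> \<rat>"
  shows "r\<^sup>2 \<noteq> real D"
proof
  assume r: "r\<^sup>2 = real D"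
  have "algebraic_int r"
    by (rule algebraic_int_root[of "real D" "monom 1 2"]) (use r in \<open>auto simp: poly_monom degree_monom_eq\<close>)
  then have "r \<in> \<int>" using assms(3) by (rule rational_algebraic_int_is_int)
  then obtain k where "r = of_int k" by (auto elim: Ints_cases)
  then have "of_int (k\<^sup>2) = (of_int (int D) :: real)" using r by simp
  then have "k\<^sup>2 = int D" by (simp only: of_int_eq_iff)
  then have D: "(nat \<bar>k\<bar>)\<^sup>2 = D" by (metis nat_abs_mult_distrib nat_int power2_eq_square abs_of_nat)
  then have "nat \<bar>k\<bar> dvd 1" using assms(1) squarefreeD[of D "nat \<bar>k\<bar>"] by simp
  then have "D = 1" using D by simp
  then show False using assms(2) by simp
qed

text \<open>1 + \<i> generates the prime ideal of norm 2, so divisibility by it is a parity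
  condition.\<close>

lemma one_plus_ii_dvd:
  assumes "even (a + b)"
  shows "\<exists>e\<in>gauss_ints. of_int a + of_int b * \<i> = (1 + \<i>) * e"
proof -
  obtain k where k: "a + b = 2 * k" using assms by (rule evenE)
  then have "b = 2 * k - a" by simp
  then have "of_int a + of_int b * \<i> = (1 + \<i>) * (of_int k + of_int (k - a) * \<i>)"
    by (simp add: complex_eq_iff)
  then show ?thesis by (intro bexI[of _ "of_int k + of_int (k - a) * \<i>"]) auto
qed

lemma gauss_ints_small:
  assumes "g \<in> gauss_ints" "cmod g < 1"
  shows "g = 0"
proof -
  obtain a b where g: "g = of_int a + of_int b * \<i>" using assms(1) unfolding gauss_ints_def by blast
  have "\<bar>real_of_int a\<bar> < 1" "\<bar>real_of_int b\<bar> < 1"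
    using abs_Re_le_cmod[of g] abs_Im_le_cmod[of g] assms(2) by (simp_all add: g)
  then show ?thesis by (simp add: g flip: of_int_abs)
qed

section \<open>Rings obtained by adjoining one element\<close>

lemma is_subring_adjoin_ring: "is_subring (adjoin_ring R a)"
  unfolding adjoin_ring_def hull_def is_subring_def by auto

lemma adjoin_ring_base: "insert a R \<subseteq> adjoin_ring R a"
  unfolding adjoin_ring_def by (rule hull_subset)

lemma adjoin_ring_subset:
  assumes "is_subring F" "insert a R \<subseteq> F"
  shows "adjoin_ring R a \<subseteq> F"
  using assms unfolding adjoin_ring_def by (intro hull_minimal)

lemma adjoin_gauss_ints_affine:
  assumes "rel_equivalent a b"
  shows "adjoin_ring gauss_ints a = adjoin_ring gauss_ints b"
proof -
  obtain u c where u: "u \<in> gauss_units" and c: "c \<in> gauss_ints" and a: "a = u * b + c"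
    using assms unfolding rel_equivalent_def by blast
  obtain v where v: "v \<in> gauss_ints" "u * v = 1" and u': "u \<in> gauss_ints"
    using u unfolding gauss_units_def by blast
  have b: "b = v * (a - c)" using v(2) by (simp add: a mult.commute mult.left_commute)
  have base: "insert d gauss_ints \<subseteq> adjoin_ring gauss_ints d" for d by (rule adjoin_ring_base)
  have ring: "0 \<in> adjoin_ring gauss_ints d" "1 \<in> adjoin_ring gauss_ints d"
    "p \<in> adjoin_ring gauss_ints d \<Longrightarrow> q \<in> adjoin_ring gauss_ints d \<Longrightarrow> p + q \<in> adjoin_ring gauss_ints d"
    "p \<in> adjoin_ring gauss_ints d \<Longrightarrow> q \<in> adjoin_ring gauss_ints d \<Longrightarrow> p - q \<in> adjoin_ring gauss_ints d"
    "p \<in> adjoin_ring gauss_ints d \<Longrightarrow> q \<in> adjoin_ring gauss_ints d \<Longrightarrow> p * q \<in> adjoin_ring gauss_ints d"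
    for d p q using is_subring_adjoin_ring[of gauss_ints d] unfolding is_subring_def by auto
  have "a \<in> adjoin_ring gauss_ints b" unfolding a using base[of b] u' c by (intro ring) auto
  moreover have "b \<in> adjoin_ring gauss_ints a" unfolding b using base[of a] v c by (intro ring) auto
  ultimately show ?thesis
    using base[of a] base[of b]
    by (intro equalityI adjoin_ring_subset is_subring_adjoin_ring) auto
qed

lemma is_subring_gauss_ints: "is_subring gauss_ints"
  unfolding is_subring_def by auto

lemma is_subring_gauss_rats: "is_subring gauss_rats"
  unfolding is_subring_def by auto

lemma gauss_rats_cmod_square:
  assumes "z \<in> gauss_rats"
  shows "(cmod z)\<^sup>2 \<in> \<rat>"
  using assms by (auto simp: cmod_power2 gauss_rats_iff)

lemmas gauss_rats_closed = gauss_rats_add gauss_rats_diff gauss_rats_mult gauss_rats_minus gauss_rats_power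
  gauss_rats_of_int gauss_rats_of_nat gauss_rats_numeral gauss_rats_zero gauss_rats_one gauss_rats_ii

lemmas gauss_ints_closed = gauss_ints_add gauss_ints_diff gauss_ints_mult gauss_ints_minus gauss_ints_power
  gauss_ints_of_int gauss_ints_of_nat gauss_ints_numeral gauss_ints_zero gauss_ints_one gauss_ints_ii

text \<open>The root is a separate last argument so that passing to a conjugate keeps the
  coefficients and replaces \<open>X\<close>.\<close>

definition cubic :: "complex \<Rightarrow> complex \<Rightarrow> complex \<Rightarrow> complex \<Rightarrow> complex \<Rightarrow> complex" where
  "cubic a b c d X = a + b * X + c * X ^ 2 + d * X ^ 3"

definition cubic_span :: "complex set \<Rightarrow> complex \<Rightarrow> complex set" where
  "cubic_span S X = {cubic a b c d X | a b c d. a \<in> S \<and> b \<in> S \<and> c \<in> S \<and> d \<in> S}"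

lemma cubic_spanI:
  "\<lbrakk>a \<in> S; b \<in> S; c \<in> S; d \<in> S; x = cubic a b c d X\<rbrakk> \<Longrightarrow> x \<in> cubic_span S X"
  unfolding cubic_span_def by blast

lemma cubic_spanE:
  assumes "x \<in> cubic_span S X"
  obtains a b c d where "a \<in> S" "b \<in> S" "c \<in> S" "d \<in> S" "x = cubic a b c d X"
  using assms unfolding cubic_span_def by blast

lemma cubic_add: "cubic a b c d X + cubic a' b' c' d' X = cubic (a + a') (b + b') (c + c') (d + d') X"
  by (simp add: cubic_def algebra_simps)

lemma cubic_diff: "cubic a b c d X - cubic a' b' c' d' X = cubic (a - a') (b - b') (c - c') (d - d') X"
  by (simp add: cubic_def algebra_simps)

lemma cubic_scale: "e * cubic a b c d X = cubic (e * a) (e * b) (e * c) (e * d) X"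
  by (simp add: cubic_def algebra_simps)

lemma cubic_neg_root: "cubic a b c d (- X) = cubic a (- b) c (- d) X"
  by (simp add: cubic_def)

lemma cubic_span_base:
  assumes "is_subring S"
  shows "insert X S \<subseteq> cubic_span S X"
proof -
  have S: "0 \<in> S" "1 \<in> S" using assms by (auto simp: is_subring_def)
  have "X \<in> cubic_span S X" by (rule cubic_spanI[of 0 S 1 0 0]) (auto simp: S cubic_def)
  moreover have "a \<in> cubic_span S X" if "a \<in> S" for a
    by (rule cubic_spanI[of a S 0 0 0]) (auto simp: S that cubic_def)
  ultimately show ?thesis by blast
qed

lemma cubic_span_subset:
  assumes "is_subring F" "insert X S \<subseteq> F"
  shows "cubic_span S X \<subseteq> F"
  using assms unfolding is_subring_def
  by (auto elim!: cubic_spanE simp: cubic_def power2_eq_square power3_eq_cube subset_iff)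

section \<open>The quartic field\<close>

locale quartic_root =
  fixes t :: nat and \<xi> :: complex
  assumes sqf: "squarefree (t\<^sup>2 + 4)"
    and root: "\<xi> ^ 4 = \<i> * of_nat t * \<xi>\<^sup>2 - 1"
begin

definition s :: complex where "s = \<i> * of_nat t"

definition is_root :: "complex \<Rightarrow> bool" where "is_root X \<longleftrightarrow> X ^ 4 = s * X\<^sup>2 - 1"

text \<open>This is 1/\<xi>, written as a polynomial in \<xi> so that its membership in Z[i][\<xi>]
  is visible.\<close>

definition \<zeta> :: complex where "\<zeta> = s * \<xi> - \<xi> ^ 3"

lemma t_odd: "odd t"
proof
  assume "even t"
  then have "2\<^sup>2 dvd t\<^sup>2 + 4" by (auto elim!: evenE simp: power2_eq_square)
  with sqf have "(2::nat) dvd 1" by (rule squarefreeD)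
  then show False by simp
qed

lemma D_odd: "odd (t\<^sup>2 + 4)"
  using t_odd by simp

lemma s_int [simp, intro]: "s \<in> gauss_ints"
  unfolding s_def by auto

lemma s_rat [simp, intro]: "s \<in> gauss_rats"
  unfolding s_def by auto

lemma s_square: "s\<^sup>2 = - of_nat (t\<^sup>2)"
  by (simp add: s_def power_mult_distrib)

lemma root_\<xi>: "is_root \<xi>"
  using root by (simp add: is_root_def s_def)

lemma root_nonzero: "is_root X \<Longrightarrow> X \<noteq> 0"
  by (auto simp: is_root_def)

lemma root_uminus: "is_root X \<Longrightarrow> is_root (- X)"
  by (simp add: is_root_def)

lemma \<xi>_\<zeta>: "\<xi> * \<zeta> = 1"
  using root_\<xi> unfolding is_root_def \<zeta>_def by Groebner_Basis.algebra

lemma \<xi>_\<zeta>_squares: "\<xi>\<^sup>2 + \<zeta>\<^sup>2 = s"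
proof -
  have "\<xi>\<^sup>2 * (\<xi>\<^sup>2 + \<zeta>\<^sup>2) = \<xi>\<^sup>2 * s"
    using \<xi>_\<zeta> root_\<xi> unfolding is_root_def by Groebner_Basis.algebra
  then show ?thesis using root_nonzero[OF root_\<xi>] by simp
qed

lemma root_\<zeta>: "is_root \<zeta>"
  unfolding is_root_def using \<xi>_\<zeta> \<xi>_\<zeta>_squares by Groebner_Basis.algebra

text \<open>The quartic reduces X^4, X^5 and X^6. The resulting coefficients are the same for every
  root, which is what carries identities from one conjugate to another.\<close>

lemma cubic_mult:
  assumes "is_root X"
  shows "cubic a0 a1 a2 a3 X * cubic b0 b1 b2 b3 X
    = cubic (a0 * b0 - (a1 * b3 + a2 * b2 + a3 * b1) - s * (a3 * b3))
            (a0 * b1 + a1 * b0 - (a2 * b3 + a3 * b2))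
            (a0 * b2 + a1 * b1 + a2 * b0 + s * (a1 * b3 + a2 * b2 + a3 * b1) + (s\<^sup>2 - 1) * (a3 * b3))
            (a0 * b3 + a1 * b2 + a2 * b1 + a3 * b0 + s * (a2 * b3 + a3 * b2)) X"
proof -
  have X4: "X ^ 4 = s * X\<^sup>2 - 1" using assms by (simp add: is_root_def)
  have X56: "X ^ 5 = s * X ^ 3 - X" "X ^ 6 = s * (s * X\<^sup>2 - 1) - X\<^sup>2"
    using X4 by Groebner_Basis.algebra+
  have "cubic a0 a1 a2 a3 X * cubic b0 b1 b2 b3 X
      = a0 * b0 + (a0 * b1 + a1 * b0) * X + (a0 * b2 + a1 * b1 + a2 * b0) * X\<^sup>2
        + (a0 * b3 + a1 * b2 + a2 * b1 + a3 * b0) * X ^ 3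
        + (a1 * b3 + a2 * b2 + a3 * b1) * X ^ 4 + (a2 * b3 + a3 * b2) * X ^ 5 + a3 * b3 * X ^ 6"
    by (simp add: cubic_def eval_nat_numeral algebra_simps)
  then show ?thesis unfolding X4 X56
    by (simp add: cubic_def power2_eq_square algebra_simps)
qed

lemma is_subring_cubic_span:
  assumes S: "is_subring S" "s \<in> S" and X: "is_root X"
  shows "is_subring (cubic_span S X)"
proof -
  have S': "0 \<in> S" "1 \<in> S" "\<And>a b. a \<in> S \<Longrightarrow> b \<in> S \<Longrightarrow> a + b \<in> S"
    "\<And>a b. a \<in> S \<Longrightarrow> b \<in> S \<Longrightarrow> a - b \<in> S" "\<And>a b. a \<in> S \<Longrightarrow> b \<in> S \<Longrightarrow> a * b \<in> S"
    using S(1) unfolding is_subring_def by auto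
  show ?thesis
    unfolding is_subring_def
  proof (intro conjI ballI)
    show "0 \<in> cubic_span S X" "1 \<in> cubic_span S X"
      by (rule cubic_spanI[of 0 S 0 0 0] cubic_spanI[of 1 S 0 0 0]; simp add: S' cubic_def)+
    fix x y assume x: "x \<in> cubic_span S X" and y: "y \<in> cubic_span S X"
    obtain a0 a1 a2 a3 where a: "a0 \<in> S" "a1 \<in> S" "a2 \<in> S" "a3 \<in> S" "x = cubic a0 a1 a2 a3 X"
      using x by (rule cubic_spanE)
    obtain b0 b1 b2 b3 where b: "b0 \<in> S" "b1 \<in> S" "b2 \<in> S" "b3 \<in> S" "y = cubic b0 b1 b2 b3 X"
      using y by (rule cubic_spanE)
    note ab = a(1-4) b(1-4) and xy = a(5) b(5)
    show "x + y \<in> cubic_span S X" unfolding xy cubic_add by (rule cubic_spanI[OF _ _ _ _ refl]; intro S' ab)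
    show "x - y \<in> cubic_span S X" unfolding xy cubic_diff by (rule cubic_spanI[OF _ _ _ _ refl]; intro S' ab)
    show "x * y \<in> cubic_span S X" unfolding xy cubic_mult[OF X] power2_eq_square
      by (rule cubic_spanI[OF _ _ _ _ refl]; intro S' ab S(2))
  qed
qed

section \<open>Independence of the powers of a root, and irreducibility\<close>

lemma D_not_square:
  assumes "r \<in> \<rat>"
  shows "r\<^sup>2 \<noteq> real (t\<^sup>2 + 4)"
  using squarefree_not_rat_square[OF sqf _ assms] by simp

text \<open>If X^2 were in Q(i), then s^2 - 4 = -(t^2 + 4) would be a square there. A square root of
  a negative real is purely imaginary, so t^2 + 4 would be a rational square.\<close>

lemma quadratic_independent:
  assumes X: "is_root X" and c: "a \<in> gauss_rats" "b \<in> gauss_rats" and eq: "a + b * X\<^sup>2 = 0"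
  shows "a = 0" "b = 0"
proof -
  show "b = 0"
  proof (rule ccontr)
    assume b: "b \<noteq> 0"
    define g where "g = - a / b"
    have g: "g \<in> gauss_rats" unfolding g_def using c by auto
    have "X\<^sup>2 = g" using eq b by (simp add: g_def field_simps eq_neg_iff_add_eq_0)
    moreover have "X ^ 4 = (X\<^sup>2)\<^sup>2" by (simp flip: power_mult)
    ultimately have "g\<^sup>2 = s * g - 1" using X by (simp add: is_root_def)
    then have "(2 * g - s)\<^sup>2 = - of_nat (t\<^sup>2) - 4" unfolding s_square[symmetric] by Groebner_Basis.algebra
    then have h: "(2 * g - s)\<^sup>2 = of_real (- real (t\<^sup>2 + 4))" by simp
    define h where "h = 2 * g - s"
    have "h \<in> gauss_rats" unfolding h_def by (intro gauss_rats_closed g s_rat)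
    then have hh: "Re h \<in> \<rat>" "Im h \<in> \<rat>" by (auto simp: gauss_rats_iff)
    have "Re (h\<^sup>2) = - real (t\<^sup>2 + 4)" "Im (h\<^sup>2) = 0"
      unfolding h_def h by simp_all
    then have "(Re h)\<^sup>2 - (Im h)\<^sup>2 = - real (t\<^sup>2 + 4)" "Re h = 0 \<or> Im h = 0"
      by (simp_all add: Re_power2 Im_power2)
    moreover have "real (t\<^sup>2 + 4) > 0" by (simp add: add_nonneg_pos)
    ultimately have "(Im h)\<^sup>2 = real (t\<^sup>2 + 4)"
      by (smt (verit, best) zero_le_power2 power_zero_numeral)
    then show False using D_not_square hh by blast
  qed
  then show "a = 0" using eq by simp
qed

text \<open>Both s + 2 and s - 2 have squared absolute value t^2 + 4, so comparing absolute values
  would make t^2 + 4 a rational square.\<close>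

lemma not_square_multiple:
  assumes "q \<in> gauss_rats" "m \<in> gauss_rats" "m \<noteq> 0" "e = 2 \<or> e = - 2"
  shows "q\<^sup>2 \<noteq> m\<^sup>2 * (s + e)"
proof
  assume eq: "q\<^sup>2 = m\<^sup>2 * (s + e)"
  define r where "r = (cmod q)\<^sup>2 / (cmod m)\<^sup>2"
  have r: "r \<in> \<rat>" unfolding r_def using assms by (auto intro!: Rats_divide gauss_rats_cmod_square)
  have "(cmod q)\<^sup>2 = (cmod m)\<^sup>2 * cmod (s + e)"
    using arg_cong[OF eq, of cmod] by (simp add: norm_mult norm_power)
  then have "r = cmod (s + e)" using assms(3) by (simp add: r_def)
  then have "r\<^sup>2 = real (t\<^sup>2 + 4)" using assms(4) by (auto simp: s_def cmod_power2)
  then show False using D_not_square r by blast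
qed

text \<open>With even part \<open>u\<close> and odd part \<open>X * w\<close>, a relation with
  \<open>w\<close> nonzero puts X = -u/w into Q(i)(X^2). Conjugating the squared relation leaves a
  sign open, so u/w has norm 1 or -1; its squared trace is then s + 2 or s - 2, which is not a
  square in Q(i).\<close>

lemma cubic_independent:
  assumes X: "is_root X"
    and c: "c0 \<in> gauss_rats" "c1 \<in> gauss_rats" "c2 \<in> gauss_rats" "c3 \<in> gauss_rats"
    and eq: "cubic c0 c1 c2 c3 X = 0"
  shows "c0 = 0 \<and> c1 = 0 \<and> c2 = 0 \<and> c3 = 0"
proof -
  define Y where "Y = inverse X"
  have XY: "X * Y = 1" using root_nonzero[OF X] by (simp add: Y_def)
  have Y2: "X\<^sup>2 + Y\<^sup>2 = s"
  proof -
    have "X\<^sup>2 * (X\<^sup>2 + Y\<^sup>2) = X\<^sup>2 * s" using X XY unfolding is_root_def by Groebner_Basis.algebra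
    then show ?thesis using root_nonzero[OF X] by simp
  qed
  have Y: "is_root Y" unfolding is_root_def using XY Y2 by Groebner_Basis.algebra
  define u w u' w' where "u = c0 + c2 * X\<^sup>2" and "w = c1 + c3 * X\<^sup>2"
    and "u' = c0 + c2 * Y\<^sup>2" and "w' = c1 + c3 * Y\<^sup>2"
  have uw: "u + X * w = 0"
    using eq by (simp add: cubic_def u_def w_def power2_eq_square power3_eq_cube algebra_simps)
  have "w = 0"
  proof (rule ccontr)
    assume w: "w \<noteq> 0"
    have w': "w' \<noteq> 0"
      using w quadratic_independent[OF Y c(2,4)] by (auto simp: w_def w'_def)
    \<comment> \<open>The left side gives the coordinates of
      \<open>u\<^sup>2 - X\<^sup>2 * w\<^sup>2\<close> with respect to 1 and X^2. They vanish, so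
      the same relation holds with \<open>Y\<close> in place of \<open>X\<close>.\<close>
    have "(c0\<^sup>2 - c2\<^sup>2 + 2 * c1 * c3 + s * c3\<^sup>2)
        + (2 * c0 * c2 + s * c2\<^sup>2 - c1\<^sup>2 + c3\<^sup>2 - 2 * s * c1 * c3 - s\<^sup>2 * c3\<^sup>2) * X\<^sup>2 = u\<^sup>2 - X\<^sup>2 * w\<^sup>2"
      using X unfolding is_root_def u_def w_def by Groebner_Basis.algebra
    also have "\<dots> = 0" using uw by Groebner_Basis.algebra
    finally have coords:
      "c0\<^sup>2 - c2\<^sup>2 + 2 * c1 * c3 + s * c3\<^sup>2 = 0"
      "2 * c0 * c2 + s * c2\<^sup>2 - c1\<^sup>2 + c3\<^sup>2 - 2 * s * c1 * c3 - s\<^sup>2 * c3\<^sup>2 = 0"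
      by (rule quadratic_independent[OF X, rotated 2]; intro gauss_rats_closed c s_rat)+
    have "u'\<^sup>2 - Y\<^sup>2 * w'\<^sup>2 = (c0\<^sup>2 - c2\<^sup>2 + 2 * c1 * c3 + s * c3\<^sup>2)
        + (2 * c0 * c2 + s * c2\<^sup>2 - c1\<^sup>2 + c3\<^sup>2 - 2 * s * c1 * c3 - s\<^sup>2 * c3\<^sup>2) * Y\<^sup>2"
      using Y unfolding is_root_def u'_def w'_def by Groebner_Basis.algebra
    then have uw': "u'\<^sup>2 = Y\<^sup>2 * w'\<^sup>2" using coords by simp
    \<comment> \<open>\<open>n / m\<close> and \<open>q / m\<close> are the norm and the trace of
      \<open>u / w\<close> over Q(i).\<close>
    define m n q where "m = w * w'" and "n = u * u'" and "q = u * w' + u' * w"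
    have m0: "m \<noteq> 0" using w w' by (simp add: m_def)
    have m: "m = c1\<^sup>2 + s * c1 * c3 + c3\<^sup>2"
      using XY Y2 unfolding m_def w_def w'_def by Groebner_Basis.algebra
    have q: "q = 2 * c0 * c1 + s * (c0 * c3 + c2 * c1) + 2 * c2 * c3"
      using XY Y2 unfolding q_def u_def w_def u'_def w'_def by Groebner_Basis.algebra
    have "u\<^sup>2 = X\<^sup>2 * w\<^sup>2" using uw by Groebner_Basis.algebra
    then have "n\<^sup>2 = (X * Y)\<^sup>2 * m\<^sup>2"
      using uw' unfolding n_def m_def by Groebner_Basis.algebra
    then have "n = m \<or> n = - m" using XY by (simp add: power2_eq_iff)
    moreover have "q\<^sup>2 = (X\<^sup>2 + Y\<^sup>2) * m\<^sup>2 + 2 * n * m"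
      using \<open>u\<^sup>2 = X\<^sup>2 * w\<^sup>2\<close> uw' unfolding q_def n_def m_def by Groebner_Basis.algebra
    ultimately have "q\<^sup>2 = m\<^sup>2 * (s + 2) \<or> q\<^sup>2 = m\<^sup>2 * (s + (- 2))"
      unfolding Y2 by (auto simp: power2_eq_square algebra_simps)
    moreover have "q \<in> gauss_rats" "m \<in> gauss_rats" unfolding q m
      by (intro gauss_rats_closed c s_rat)+
    ultimately show False using not_square_multiple m0 by blast
  qed
  moreover from this have "u = 0" using uw by simp
  ultimately show ?thesis
    using quadratic_independent[OF X c(2,4)] quadratic_independent[OF X c(1,3)]
    by (simp add: u_def w_def)
qed

lemma cubic_eq_iff:
  assumes "is_root X"
    and "a0 \<in> gauss_rats" "a1 \<in> gauss_rats" "a2 \<in> gauss_rats" "a3 \<in> gauss_rats"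
    and "b0 \<in> gauss_rats" "b1 \<in> gauss_rats" "b2 \<in> gauss_rats" "b3 \<in> gauss_rats"
  shows "cubic a0 a1 a2 a3 X = cubic b0 b1 b2 b3 X \<longleftrightarrow> a0 = b0 \<and> a1 = b1 \<and> a2 = b2 \<and> a3 = b3"
proof
  assume "cubic a0 a1 a2 a3 X = cubic b0 b1 b2 b3 X"
  then have "cubic (a0 - b0) (a1 - b1) (a2 - b2) (a3 - b3) X = 0"
    using cubic_diff[of a0 a1 a2 a3 X b0 b1 b2 b3] by simp
  then show "a0 = b0 \<and> a1 = b1 \<and> a2 = b2 \<and> a3 = b3"
    using cubic_independent[OF assms(1), of "a0 - b0" "a1 - b1" "a2 - b2" "a3 - b3"] assms by auto
qed simp

text \<open>One factor vanishes at \<xi>; if its degree is below 4, its coefficients are a linear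
  relation between 1, \<xi>, \<xi>^2, \<xi>^3 and must all be 0.\<close>

lemma irreducible_quartic: "irreducible_over gauss_rats (quartic t)"
proof -
  have small: "p = 0" if p: "set (coeffs p) \<subseteq> gauss_rats" "degree p < 4" "poly p \<xi> = 0" for p
  proof -
    have c: "coeff p i \<in> gauss_rats" for i
    proof (cases "coeff p i = 0")
      case False
      then have "coeff p i \<in> set (coeffs p)"
        by (intro coeff_in_coeffs) (auto intro: le_degree)
      then show ?thesis using p(1) by blast
    qed simp
    have "poly p \<xi> = (\<Sum>i\<le>3. coeff p i * \<xi> ^ i)"
      using p(2) unfolding poly_altdef by (intro sum.mono_neutral_left) (auto simp: coeff_eq_0)
    then have "cubic (coeff p 0) (coeff p 1) (coeff p 2) (coeff p 3) \<xi> = 0"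
      using p(3) by (simp add: cubic_def numeral_eq_Suc)
    then have z: "coeff p 0 = 0 \<and> coeff p 1 = 0 \<and> coeff p 2 = 0 \<and> coeff p 3 = 0"
      by (rule cubic_independent[OF root_\<xi> c c c c])
    have "coeff p i = 0" for i
    proof (cases "i < 4")
      case True
      then have "i = 0 \<or> i = 1 \<or> i = 2 \<or> i = 3" by linarith
      then show ?thesis using z by auto
    next
      case False
      then show ?thesis using p(2) by (simp add: coeff_eq_0)
    qed
    then show ?thesis by (simp add: poly_eq_iff)
  qed
  have deg: "degree (quartic t) = 4" by (simp add: quartic_def)
  have zero: "poly (quartic t) \<xi> = 0"
    using root by (simp add: quartic_def power2_eq_square power4_eq_xxxx algebra_simps)
  have "set (coeffs (quartic t)) \<subseteq> gauss_rats"
    by (auto simp: quartic_def)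
  moreover have "degree g = 0 \<or> degree h = 0"
    if gh: "set (coeffs g) \<subseteq> gauss_rats" "set (coeffs h) \<subseteq> gauss_rats" "quartic t = g * h" for g h
  proof (rule ccontr)
    assume d: "\<not> (degree g = 0 \<or> degree h = 0)"
    have "quartic t \<noteq> 0" using deg by auto
    then have nz: "g \<noteq> 0" "h \<noteq> 0" using gh(3) by auto
    then have "degree g + degree h = 4" using gh(3) deg by (simp add: degree_mult_eq)
    then have "degree g < 4" "degree h < 4" using d by auto
    moreover have "poly g \<xi> = 0 \<or> poly h \<xi> = 0" using zero gh(3) by simp
    ultimately show False using small gh nz by blast
  qed
  ultimately show ?thesis unfolding irreducible_over_def using deg by simp
qed

text \<open>Values of one integer polynomial at the two conjugates have the same coordinates. When
  the value at \<open>X\<close> is 0, independence makes these coordinates 0, and the value at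
  \<open>Y\<close> vanishes with them.\<close>

lemma algebraic_int_conjugate:
  assumes X: "is_root X" and Y: "is_root Y"
    and c: "c0 \<in> gauss_rats" "c1 \<in> gauss_rats" "c2 \<in> gauss_rats" "c3 \<in> gauss_rats"
    and int: "algebraic_int (cubic c0 c1 c2 c3 X)"
  shows "algebraic_int (cubic c0 c1 c2 c3 Y)"
proof -
  have graph: "\<exists>d0\<in>gauss_rats. \<exists>d1\<in>gauss_rats. \<exists>d2\<in>gauss_rats. \<exists>d3\<in>gauss_rats.
      poly (map_poly of_int p) (cubic c0 c1 c2 c3 X) = cubic d0 d1 d2 d3 X \<and>
      poly (map_poly of_int p) (cubic c0 c1 c2 c3 Y) = cubic d0 d1 d2 d3 Y" for p :: "int poly"
  proof (induction p)
    case 0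
    show ?case by (intro bexI[of _ 0]) (auto simp: cubic_def)
  next
    case (pCons a p)
    then obtain d0 d1 d2 d3 where d: "d0 \<in> gauss_rats" "d1 \<in> gauss_rats" "d2 \<in> gauss_rats" "d3 \<in> gauss_rats"
      and eq: "poly (map_poly of_int p) (cubic c0 c1 c2 c3 X) = cubic d0 d1 d2 d3 X"
        "poly (map_poly of_int p) (cubic c0 c1 c2 c3 Y) = cubic d0 d1 d2 d3 Y" by blast
    define e0 e1 e2 e3 where "e0 = of_int a + (c0 * d0 - (c1 * d3 + c2 * d2 + c3 * d1) - s * (c3 * d3))"
      and "e1 = c0 * d1 + c1 * d0 - (c2 * d3 + c3 * d2)"
      and "e2 = c0 * d2 + c1 * d1 + c2 * d0 + s * (c1 * d3 + c2 * d2 + c3 * d1) + (s\<^sup>2 - 1) * (c3 * d3)"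
      and "e3 = c0 * d3 + c1 * d2 + c2 * d1 + c3 * d0 + s * (c2 * d3 + c3 * d2)"
    note e_defs = e0_def e1_def e2_def e3_def
    have e: "e0 \<in> gauss_rats" "e1 \<in> gauss_rats" "e2 \<in> gauss_rats" "e3 \<in> gauss_rats"
      unfolding e_defs by (intro gauss_rats_closed c d s_rat)+
    have step: "poly (map_poly of_int (pCons a p)) z = cubic (of_int a) 0 0 0 Z + z * poly (map_poly of_int p) z"
      for z Z by (simp add: of_int_hom.map_poly_pCons_hom cubic_def)
    have "poly (map_poly of_int (pCons a p)) (cubic c0 c1 c2 c3 X) = cubic e0 e1 e2 e3 X"
      unfolding step[of _ X] eq cubic_mult[OF X] cubic_add by (simp add: e_defs)
    moreover have "poly (map_poly of_int (pCons a p)) (cubic c0 c1 c2 c3 Y) = cubic e0 e1 e2 e3 Y"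
      unfolding step[of _ Y] eq cubic_mult[OF Y] cubic_add by (simp add: e_defs)
    ultimately show ?case using e by blast
  qed
  obtain p where p: "poly (map_poly of_int p) (cubic c0 c1 c2 c3 X) = 0" "lead_coeff p = 1"
    using int unfolding algebraic_int_altdef_ipoly by blast
  obtain d0 d1 d2 d3 where d: "d0 \<in> gauss_rats" "d1 \<in> gauss_rats" "d2 \<in> gauss_rats" "d3 \<in> gauss_rats"
    and eq: "poly (map_poly of_int p) (cubic c0 c1 c2 c3 X) = cubic d0 d1 d2 d3 X"
      "poly (map_poly of_int p) (cubic c0 c1 c2 c3 Y) = cubic d0 d1 d2 d3 Y" using graph[of p] by blast
  have "d0 = 0 \<and> d1 = 0 \<and> d2 = 0 \<and> d3 = 0"
    using eq(1) p(1) by (intro cubic_independent[OF X d]) simp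
  then have "poly (map_poly of_int p) (cubic c0 c1 c2 c3 Y) = 0"
    using eq(2) by (simp add: cubic_def)
  then show ?thesis using p(2) unfolding algebraic_int_altdef_ipoly by blast
qed

text \<open>The denominator is rationalised twice: \<open>v'\<close> is the conjugate at -\<xi>,
  which brings the product into Q(i)(\<xi>^2), and \<open>v''\<close> is the conjugate
  \<open>a + b * \<zeta>\<^sup>2\<close> there, rewritten with \<zeta>^2 = s - \<xi>^2.\<close>

lemma is_subfield_cubic_span: "is_subfield (cubic_span gauss_rats \<xi>)"
proof -
  have ring: "is_subring (cubic_span gauss_rats \<xi>)"
    by (rule is_subring_cubic_span[OF is_subring_gauss_rats s_rat root_\<xi>])
  have "inverse v \<in> cubic_span gauss_rats \<xi>" if v: "v \<in> cubic_span gauss_rats \<xi>" for v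
  proof (cases "v = 0")
    case True
    then show ?thesis using v by simp
  next
    case False
    obtain c0 c1 c2 c3 where c: "c0 \<in> gauss_rats" "c1 \<in> gauss_rats" "c2 \<in> gauss_rats" "c3 \<in> gauss_rats"
      and veq: "v = cubic c0 c1 c2 c3 \<xi>" using v by (rule cubic_spanE)
    define a b where "a = c0\<^sup>2 - c2\<^sup>2 + 2 * c1 * c3 + s * c3\<^sup>2"
      and "b = 2 * c0 * c2 + s * c2\<^sup>2 - c1\<^sup>2 + c3\<^sup>2 - 2 * s * c1 * c3 - s\<^sup>2 * c3\<^sup>2"
    have ab: "a \<in> gauss_rats" "b \<in> gauss_rats" unfolding a_def b_def by (intro gauss_rats_closed c s_rat)+
    define v' where "v' = cubic c0 (- c1) c2 (- c3) \<xi>"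
    define v'' where "v'' = cubic (a + b * s) 0 (- b) 0 \<xi>"
    define N where "N = a\<^sup>2 + s * a * b + b\<^sup>2"
    have prod: "v * v' = a + b * \<xi>\<^sup>2"
      using root_\<xi> unfolding veq v'_def cubic_def a_def b_def is_root_def by Groebner_Basis.algebra
    have N: "(a + b * \<xi>\<^sup>2) * v'' = N"
      using root_\<xi> unfolding v''_def cubic_def N_def is_root_def by Groebner_Basis.algebra
    have "v' \<noteq> 0"
    proof
      assume "v' = 0"
      then have "c0 = 0 \<and> - c1 = 0 \<and> c2 = 0 \<and> - c3 = 0"
        unfolding v'_def by (intro cubic_independent[OF root_\<xi>]) (use c in auto)
      then show False using False by (simp add: veq cubic_def)
    qed
    then have ab0: "a + b * \<xi>\<^sup>2 \<noteq> 0" using False prod by force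
    have "v'' \<noteq> 0"
    proof
      assume "v'' = 0"
      then have "a + b * \<zeta>\<^sup>2 = 0"
        using \<xi>_\<zeta>_squares unfolding v''_def cubic_def by Groebner_Basis.algebra
      then have "a = 0" "b = 0" using quadratic_independent[OF root_\<zeta> ab] by blast+
      then show False using ab0 by simp
    qed
    then have "N \<noteq> 0" using N ab0 by force
    moreover have "v * (v' * v'') = N" using prod N by (simp add: mult.assoc[symmetric])
    ultimately have "inverse v = inverse N * (v' * v'')"
      using False by (simp add: field_simps)
    moreover have "inverse N \<in> gauss_rats"
      unfolding N_def by (intro gauss_rats_inverse gauss_rats_closed ab s_rat)
    then have "inverse N \<in> cubic_span gauss_rats \<xi>"
      by (intro cubic_spanI[of "inverse N" _ 0 0 0]) (auto simp: cubic_def)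
    moreover have "v' \<in> cubic_span gauss_rats \<xi>" "v'' \<in> cubic_span gauss_rats \<xi>"
      unfolding v'_def v''_def by (rule cubic_spanI[OF _ _ _ _ refl]; use c ab in auto)+
    ultimately show ?thesis using ring unfolding is_subring_def by auto
  qed
  then show ?thesis using ring unfolding is_subfield_def by blast
qed

subsection \<open>The ring of integers\<close>

lemma algebraic_int_\<xi> [intro]: "algebraic_int \<xi>"
proof -
  \<comment> \<open>Squaring removes \<i>, because s^2 = -t^2 is an integer, and leaves a monic
    integer equation of degree 8.\<close>
  have "(\<xi> ^ 4 + 1)\<^sup>2 = s\<^sup>2 * \<xi> ^ 4"
    using root_\<xi> unfolding is_root_def by Groebner_Basis.algebra
  then have "\<xi> ^ 8 + (2 + of_nat (t\<^sup>2)) * \<xi> ^ 4 + 1 = 0"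
    unfolding s_square by Groebner_Basis.algebra
  then have "poly (map_poly of_int [:1, 0, 0, 0, 2 + int (t\<^sup>2), 0, 0, 0, 1:]) \<xi> = 0"
    by (simp add: map_poly_pCons eval_nat_numeral algebra_simps)
  moreover have "lead_coeff [:1, 0, 0, 0, 2 + int (t\<^sup>2), 0, 0, 0, 1:] = 1" by simp
  ultimately show ?thesis unfolding algebraic_int_altdef_ipoly by blast
qed

lemma algebraic_int_cubic_span:
  assumes "v \<in> cubic_span gauss_ints \<xi>"
  shows "algebraic_int v"
  using assms
proof (rule cubic_spanE)
  fix a b c d assume "a \<in> gauss_ints" "b \<in> gauss_ints" "c \<in> gauss_ints" "d \<in> gauss_ints"
    and v: "v = cubic a b c d \<xi>"
  then show ?thesis unfolding v cubic_def
    by (intro algebraic_int_closed algebraic_int_\<xi>) (auto intro: gauss_ints_algebraic_int)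
qed

lemma algebraic_int_\<zeta> [intro]: "algebraic_int \<zeta>"
  unfolding \<zeta>_def
  by (intro algebraic_int_closed algebraic_int_\<xi>) (auto intro: gauss_ints_algebraic_int)

text \<open>Subtracting the conjugate leaves b(\<xi>^2 - \<zeta>^2), whose square is -b^2(t^2 + 4).
  As t^2 + 4 is odd and squarefree, integrality of this square excludes any denominator in
  \<open>b\<close>.\<close>

lemma quadratic_integral:
  assumes c: "a \<in> gauss_rats" "b \<in> gauss_rats" and int: "algebraic_int (a + b * \<xi>\<^sup>2)"
  shows "a \<in> gauss_ints" "b \<in> gauss_ints"
proof -
  have "algebraic_int (cubic a 0 b 0 \<xi>)" using int by (simp add: cubic_def)
  then have "algebraic_int (cubic a 0 b 0 \<zeta>)"
    by (rule algebraic_int_conjugate[OF root_\<xi> root_\<zeta>, rotated 4]) (use c in auto)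
  then have "algebraic_int (- (((a + b * \<xi>\<^sup>2) - cubic a 0 b 0 \<zeta>)\<^sup>2))" using int by auto
  also have "- (((a + b * \<xi>\<^sup>2) - cubic a 0 b 0 \<zeta>)\<^sup>2) = b\<^sup>2 * (4 - s\<^sup>2)"
    using \<xi>_\<zeta> \<xi>_\<zeta>_squares unfolding cubic_def by Groebner_Basis.algebra
  also have "\<dots> = b\<^sup>2 * of_nat (t\<^sup>2 + 4)" unfolding s_square by simp
  finally have "b\<^sup>2 * of_nat (t\<^sup>2 + 4) \<in> gauss_ints"
    by (rule gauss_rats_algebraic_int[rotated]) (intro gauss_rats_closed c)
  then show b: "b \<in> gauss_ints"
    by (rule gauss_rats_square_sqfree[OF c(2) sqf D_odd])
  have "algebraic_int ((a + b * \<xi>\<^sup>2) - b * \<xi>\<^sup>2)"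
    by (rule algebraic_int_diff[OF int])
      (intro algebraic_int_closed algebraic_int_\<xi> gauss_ints_algebraic_int[OF b])
  then show "a \<in> gauss_ints" using c by (simp add: gauss_rats_algebraic_int)
qed

text \<open>Squaring kills the odd-degree coefficients modulo 2, so integrality of \<open>v\<^sup>2\<close> is a statement
  about the quadratic subfield.\<close>

lemma divide_one_plus_ii:
  assumes v: "algebraic_int v" "(1 + \<i>) * v = cubic d0 d1 d2 d3 \<xi>"
    and d: "d0 \<in> gauss_ints" "d1 \<in> gauss_ints" "d2 \<in> gauss_ints" "d3 \<in> gauss_ints"
  shows "\<exists>e0\<in>gauss_ints. \<exists>e1\<in>gauss_ints. \<exists>e2\<in>gauss_ints. \<exists>e3\<in>gauss_ints.
    d0 = (1 + \<i>) * e0 \<and> d1 = (1 + \<i>) * e1 \<and> d2 = (1 + \<i>) * e2 \<and> d3 = (1 + \<i>) * e3"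
proof -
  \<comment> \<open>\<open>E0\<close>, \<open>2 * h1\<close>, \<open>E2\<close>,
    \<open>2 * h3\<close> are the coordinates of the square of \<open>(1 + \<i>) * v\<close>, which
    is \<open>2 * \<i> * v\<^sup>2\<close>. The odd-degree ones stay integral after division by
    \<open>2 * \<i>\<close> and can be moved to the side of \<open>v\<^sup>2\<close>.\<close>
  define E0 where "E0 = d0\<^sup>2 - (2 * d1 * d3 + d2\<^sup>2) - s * d3\<^sup>2"
  define E2 where "E2 = 2 * d0 * d2 + d1\<^sup>2 + s * (2 * d1 * d3 + d2\<^sup>2) + (s\<^sup>2 - 1) * d3\<^sup>2"
  define h1 where "h1 = d0 * d1 - d2 * d3"
  define h3 where "h3 = d0 * d3 + d1 * d2 + s * (d2 * d3)"
  have E: "E0 \<in> gauss_ints" "E2 \<in> gauss_ints" "h1 \<in> gauss_ints" "h3 \<in> gauss_ints"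
    unfolding E0_def E2_def h1_def h3_def by (intro gauss_ints_closed d s_int)+
  have "2 * \<i> * v\<^sup>2 = ((1 + \<i>) * v)\<^sup>2" by (simp add: power2_eq_square algebra_simps)
  also have "\<dots> = cubic E0 (2 * h1) E2 (2 * h3) \<xi>"
    unfolding v(2) power2_eq_square cubic_mult[OF root_\<xi>]
    by (simp add: E0_def E2_def h1_def h3_def power2_eq_square algebra_simps)
  finally have "2 * \<i> * (v\<^sup>2 + \<i> * (h1 * \<xi> + h3 * \<xi> ^ 3)) = E0 + E2 * \<xi>\<^sup>2"
    by (simp add: cubic_def algebra_simps)
  then have "v\<^sup>2 + \<i> * (h1 * \<xi> + h3 * \<xi> ^ 3) = E0 / (2 * \<i>) + E2 / (2 * \<i>) * \<xi>\<^sup>2"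
    by (simp add: field_simps)
  moreover have "algebraic_int (v\<^sup>2 + \<i> * (h1 * \<xi> + h3 * \<xi> ^ 3))"
    using E by (intro algebraic_int_closed algebraic_int_\<xi> v(1)) (auto intro: gauss_ints_algebraic_int)
  ultimately have int: "algebraic_int (E0 / (2 * \<i>) + E2 / (2 * \<i>) * \<xi>\<^sup>2)" by simp
  have "E0 / (2 * \<i>) \<in> gauss_rats" "E2 / (2 * \<i>) \<in> gauss_rats"
    by (intro gauss_rats_divide gauss_rats_closed gauss_ints_imp_rats E)+
  then have "E0 / (2 * \<i>) \<in> gauss_ints" "E2 / (2 * \<i>) \<in> gauss_ints"
    using quadratic_integral[OF _ _ int] by blast+
  then obtain p q p' q' where "E0 / (2 * \<i>) = of_int p + of_int q * \<i>"
    "E2 / (2 * \<i>) = of_int p' + of_int q' * \<i>" unfolding gauss_ints_def by blast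
  then have E02: "E0 = 2 * \<i> * (of_int p + of_int q * \<i>)" "E2 = 2 * \<i> * (of_int p' + of_int q' * \<i>)"
    by (simp_all add: field_simps)
  obtain a0 b0 where d0: "d0 = of_int a0 + of_int b0 * \<i>" using d(1) unfolding gauss_ints_def by blast
  obtain a1 b1 where d1: "d1 = of_int a1 + of_int b1 * \<i>" using d(2) unfolding gauss_ints_def by blast
  obtain a2 b2 where d2: "d2 = of_int a2 + of_int b2 * \<i>" using d(3) unfolding gauss_ints_def by blast
  obtain a3 b3 where d3: "d3 = of_int a3 + of_int b3 * \<i>" using d(4) unfolding gauss_ints_def by blast
  \<comment> \<open>Modulo 2 the square of a + b\<i> is real and congruent to a + b, and
    \<open>s\<close> is \<i> times an odd number. So the imaginary part of \<open>E0\<close>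
    isolates \<open>d3\<close> and that of \<open>E2\<close> isolates \<open>d2\<close>; the real
    part of \<open>E0\<close> then gives \<open>d0\<close>, and that of \<open>E2\<close> gives
    \<open>d1\<close> because t^2 + 1 is even.\<close>
  have "of_int (int t * (a3\<^sup>2 - b3\<^sup>2))
      = (of_int (2 * (a0 * b0 - a1 * b3 - b1 * a3 - a2 * b2 - p)) :: real)"
    using E02(1) unfolding E0_def d0 d1 d2 d3 s_def
    by (simp add: complex_eq_iff power2_eq_square algebra_simps)
  then have "even (int t * (a3\<^sup>2 - b3\<^sup>2))" by (simp only: of_int_eq_iff dvd_triv_left)
  then have e3: "even (a3 + b3)" using t_odd by simp
  have "of_int (a0\<^sup>2 - b0\<^sup>2 - (a2\<^sup>2 - b2\<^sup>2))
      = (of_int (2 * (a1 * a3 - b1 * b3 - int t * a3 * b3 - q)) :: real)"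
    using E02(1) unfolding E0_def d0 d1 d2 d3 s_def
    by (simp add: complex_eq_iff power2_eq_square algebra_simps)
  then have "even (a0\<^sup>2 - b0\<^sup>2 - (a2\<^sup>2 - b2\<^sup>2))" by (simp only: of_int_eq_iff dvd_triv_left)
  then have e02: "even (a0 + b0 + (a2 + b2))" by simp
  have "of_int (int t * (a2\<^sup>2 - b2\<^sup>2))
      = (of_int (2 * (p' - (a0 * b2 + b0 * a2) - a1 * b1 - int t * (a1 * a3 - b1 * b3)
          + ((int t)\<^sup>2 + 1) * a3 * b3)) :: real)"
    using E02(2) unfolding E2_def d0 d1 d2 d3 s_def
    by (simp add: complex_eq_iff power2_eq_square algebra_simps)
  then have "even (int t * (a2\<^sup>2 - b2\<^sup>2))" by (simp only: of_int_eq_iff dvd_triv_left)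
  then have e2: "even (a2 + b2)" using t_odd by simp
  have "of_int (a1\<^sup>2 - b1\<^sup>2 - ((int t)\<^sup>2 + 1) * (a3\<^sup>2 - b3\<^sup>2))
      = (of_int (2 * (int t * (a1 * b3 + b1 * a3) + int t * a2 * b2 - q' - (a0 * a2 - b0 * b2))) :: real)"
    using E02(2) unfolding E2_def d0 d1 d2 d3 s_def
    by (simp add: complex_eq_iff power2_eq_square algebra_simps)
  then have "even (a1\<^sup>2 - b1\<^sup>2 - ((int t)\<^sup>2 + 1) * (a3\<^sup>2 - b3\<^sup>2))"
    by (simp only: of_int_eq_iff dvd_triv_left)
  then have e1: "even (a1 + b1)" using t_odd by simp
  have e0: "even (a0 + b0)" using e02 e2 by simp
  show ?thesis
    using one_plus_ii_dvd[OF e0] one_plus_ii_dvd[OF e1] one_plus_ii_dvd[OF e2] one_plus_ii_dvd[OF e3]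
    unfolding d0 d1 d2 d3 by blast
qed

text \<open>The conjugate at -\<xi> separates even from odd coordinates, the odd part being divided
  by the unit \<xi>; only 2 can remain as a denominator. Up to a unit 2 is (1 + \<i>)^2, so two
  applications of \<open>divide_one_plus_ii\<close> remove it, the first to
  \<open>(1 - \<i>) * v\<close> and the second to \<open>v\<close>.\<close>

lemma cubic_integral:
  assumes c: "c0 \<in> gauss_rats" "c1 \<in> gauss_rats" "c2 \<in> gauss_rats" "c3 \<in> gauss_rats"
    and int: "algebraic_int (cubic c0 c1 c2 c3 \<xi>)"
  shows "cubic c0 c1 c2 c3 \<xi> \<in> cubic_span gauss_ints \<xi>"
proof -
  define v where "v = cubic c0 c1 c2 c3 \<xi>"
  define v' where "v' = cubic c0 (- c1) c2 (- c3) \<xi>"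
  have v: "algebraic_int v" using int by (simp add: v_def)
  have v': "algebraic_int v'"
    using algebraic_int_conjugate[OF root_\<xi> root_uminus[OF root_\<xi>] c int]
    by (simp add: cubic_neg_root v'_def)
  have "algebraic_int (v + v')" "algebraic_int ((v - v') * \<zeta>)" using v v' by auto
  moreover have "v + v' = 2 * c0 + 2 * c2 * \<xi>\<^sup>2" by (simp add: v_def v'_def cubic_def)
  moreover have "(v - v') * \<zeta> = 2 * c1 + 2 * c3 * \<xi>\<^sup>2"
    using \<xi>_\<zeta> unfolding v_def v'_def cubic_def by Groebner_Basis.algebra
  ultimately have d: "2 * c0 \<in> gauss_ints" "2 * c2 \<in> gauss_ints" "2 * c1 \<in> gauss_ints" "2 * c3 \<in> gauss_ints"
    using quadratic_integral[of "2 * c0" "2 * c2"] quadratic_integral[of "2 * c1" "2 * c3"] c by auto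
  have "(1 + \<i>) * ((1 - \<i>) * v) = cubic (2 * c0) (2 * c1) (2 * c2) (2 * c3) \<xi>"
    unfolding v_def cubic_scale[symmetric] by (simp add: algebra_simps)
  moreover have "algebraic_int ((1 - \<i>) * v)" using v by auto
  ultimately obtain e0 e1 e2 e3 where e: "e0 \<in> gauss_ints" "e1 \<in> gauss_ints" "e2 \<in> gauss_ints" "e3 \<in> gauss_ints"
    and ce: "2 * c0 = (1 + \<i>) * e0" "2 * c1 = (1 + \<i>) * e1" "2 * c2 = (1 + \<i>) * e2" "2 * c3 = (1 + \<i>) * e3"
    using divide_one_plus_ii[of "(1 - \<i>) * v" "2 * c0" "2 * c1" "2 * c2" "2 * c3"] d by blast
  have step: "(1 + \<i>) * c = \<i> * e" if "2 * c = (1 + \<i>) * e" for c e :: complex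
  proof -
    have "2 * ((1 + \<i>) * c) = (1 + \<i>) * ((1 + \<i>) * e)" unfolding that[symmetric] by simp
    also have "\<dots> = 2 * (\<i> * e)" by (simp add: algebra_simps)
    finally show ?thesis by simp
  qed
  have "(1 + \<i>) * v = cubic (\<i> * e0) (\<i> * e1) (\<i> * e2) (\<i> * e3) \<xi>"
    unfolding v_def cubic_scale step[OF ce(1)] step[OF ce(2)] step[OF ce(3)] step[OF ce(4)] ..
  then obtain f0 f1 f2 f3 where f: "f0 \<in> gauss_ints" "f1 \<in> gauss_ints" "f2 \<in> gauss_ints" "f3 \<in> gauss_ints"
    and ef: "\<i> * e0 = (1 + \<i>) * f0" "\<i> * e1 = (1 + \<i>) * f1" "\<i> * e2 = (1 + \<i>) * f2" "\<i> * e3 = (1 + \<i>) * f3"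
    using divide_one_plus_ii[OF v, of "\<i> * e0" "\<i> * e1" "\<i> * e2" "\<i> * e3"] e by blast
  have "(1 + \<i>) * v = (1 + \<i>) * cubic f0 f1 f2 f3 \<xi>"
    unfolding cubic_scale ef[symmetric] by fact
  moreover have "1 + \<i> \<noteq> 0" by (simp add: complex_eq_iff)
  ultimately have "v = cubic f0 f1 f2 f3 \<xi>" by simp
  then show ?thesis unfolding v_def[symmetric] by (intro cubic_spanI[OF f])
qed

lemma adjoin_field_eq: "adjoin_field gauss_rats \<xi> = cubic_span gauss_rats \<xi>"
proof
  show "adjoin_field gauss_rats \<xi> \<subseteq> cubic_span gauss_rats \<xi>"
    unfolding adjoin_field_def
    by (intro hull_minimal cubic_span_base is_subring_gauss_rats is_subfield_cubic_span)
  show "cubic_span gauss_rats \<xi> \<subseteq> adjoin_field gauss_rats \<xi>"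
    unfolding adjoin_field_def hull_def is_subfield_def using cubic_span_subset by blast
qed

lemma ring_of_integers_eq:
  "ring_of_integers (adjoin_field gauss_rats \<xi>) = cubic_span gauss_ints \<xi>"
proof
  show "ring_of_integers (adjoin_field gauss_rats \<xi>) \<subseteq> cubic_span gauss_ints \<xi>"
    unfolding ring_of_integers_def adjoin_field_eq
    by (auto elim!: cubic_spanE[of _ gauss_rats] intro: cubic_integral)
  have "cubic_span gauss_ints \<xi> \<subseteq> cubic_span gauss_rats \<xi>"
    unfolding cubic_span_def using gauss_ints_imp_rats by blast
  then show "cubic_span gauss_ints \<xi> \<subseteq> ring_of_integers (adjoin_field gauss_rats \<xi>)"
    unfolding ring_of_integers_def adjoin_field_eq using algebraic_int_cubic_span by blast
qed

end

section \<open>The Pell equation\<close>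

text \<open>Here \<open>r\<close> stands for S - tW and \<open>e\<close> for the value W^2 - Sr of
  the form, so t = (W^2 - e - r^2)/(Wr) and a divisibility test replaces a loop over t. The bound 29
  comes from W^2 < WS <= 900, and 21 is the largest c with 2c^2 <= 900.\<close>

lemma pell_double_square_search:
  "list_all (\<lambda>W. list_all (\<lambda>r. list_all (\<lambda>e. (W * W - e - r * r) mod (W * r) = 0 \<longrightarrow>
     list_all (\<lambda>c. W * (r + (W * W - e - r * r) div (W * r) * W) = 2 * c * c \<longrightarrow>
       (W * W - e - r * r) div (W * r) = 1 \<and> W = 1 \<and> r = 1) [1..21]) [1, -1]) [1..W]) [1..29::int]"
  by code_simp

lemma pell_double_square_pos:
  fixes W S t c :: int
  assumes t: "t \<ge> 1" "odd t" and pos: "W > 0" "S > 0"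
    and norm: "\<bar>W\<^sup>2 + t * W * S - S\<^sup>2\<bar> = 1" and WS: "W * S = 2 * c\<^sup>2" "W * S \<le> 900"
  shows "t = 1 \<and> W = 1 \<and> S = 2"
proof -
  define e where "e = W\<^sup>2 + t * W * S - S\<^sup>2"
  define r where "r = S - t * W"
  have e: "e = 1 \<or> e = - 1" using norm by (auto simp: e_def abs_if split: if_splits)
  have S: "S = r + t * W" by (simp add: r_def)
  have Sr: "S * r = W\<^sup>2 - e" by (simp add: e_def r_def power2_eq_square algebra_simps)
  have W1: "W\<^sup>2 \<ge> 1" using pos(1) by simp
  \<comment> \<open>W = 1, S = t solves the equation for every t; it is excluded by parity, since
    then t = 2c^2.\<close>
  have "r \<noteq> 0"
  proof
    assume "r = 0"
    then have "W\<^sup>2 = e" using Sr by simp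
    then have "W\<^sup>2 = 1" using e W1 by auto
    then have "W = 1" using pos(1) by (simp add: power2_eq_1_iff)
    then have "t = 2 * c\<^sup>2" using WS(1) S \<open>r = 0\<close> by simp
    then show False using t(2) by simp
  qed
  moreover have "S * r \<ge> 0" using Sr e W1 by auto
  then have "r \<ge> 0" using pos(2) by (simp add: zero_le_mult_iff)
  ultimately have r: "r \<ge> 1" by simp
  have tW: "W \<le> t * W" using t(1) pos(1) by simp
  have "W < S" using S r tW by linarith
  then have "W * W < W * S" using pos(1) by simp
  then have "W\<^sup>2 < 30\<^sup>2" using WS(2) by (simp add: power2_eq_square)
  then have W29: "W \<le> 29" using power_less_imp_less_base[of W 2 30] by simp
  \<comment> \<open>Otherwise S >= r + W >= 2W + 1, and \<open>S * r\<close> exceeds W^2 +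
    1.\<close>
  have rW: "r \<le> W"
  proof (rule ccontr)
    assume "\<not> r \<le> W"
    then have "r \<ge> W + 1" by simp
    moreover have "S \<ge> r + W" using S tW by simp
    ultimately have "S * r \<ge> (2 * W + 1) * (W + 1)" using pos(1) by (intro mult_mono) auto
    then show False using Sr e pos(1) mult_pos_pos[OF pos(1) pos(1)] by (auto simp: power2_eq_square algebra_simps)
  qed
  have eq: "W * W - e - r * r = t * (W * r)"
    using Sr unfolding S by (simp add: power2_eq_square algebra_simps)
  have nz: "W * r \<noteq> 0" using pos(1) r by simp
  have t_eq: "(W * W - e - r * r) div (W * r) = t" unfolding eq using nz by simp
  have m: "(W * W - e - r * r) mod (W * r) = 0" unfolding eq by simp
  define d where "d = \<bar>c\<bar>"
  have d: "W * S = 2 * d * d" using WS(1) by (simp add: d_def power2_eq_square)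
  have "d \<noteq> 0" using d pos by auto
  then have "d \<ge> 1" by (simp add: d_def)
  moreover have "d \<le> 21"
  proof (rule ccontr)
    assume "\<not> d \<le> 21"
    then have "d * d \<ge> 22 * 22" by (intro mult_mono) auto
    then show False using d WS(2) by simp
  qed
  ultimately have dm: "d \<in> set [1..21]" by simp
  have Wm: "W \<in> set [1..29]" and rm: "r \<in> set [1..W]" and em: "e \<in> set [1, -1]"
    using W29 pos(1) r rW e by auto
  have "t = 1 \<and> W = 1 \<and> r = 1"
    using pell_double_square_search[unfolded list_all_iff, rule_format, OF Wm rm em m dm]
    unfolding t_eq S[symmetric] using d by simp
  then show ?thesis using S by simp
qed

text \<open>The form is invariant under negating both entries and changes sign under (W, S) -> (S,
  -W), so every sign pattern reduces to positive entries.\<close>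

lemma pell_double_square:
  fixes W S t c :: int
  assumes t: "t \<ge> 1" "odd t"
    and norm: "\<bar>W\<^sup>2 + t * W * S - S\<^sup>2\<bar> = 1" and WS: "\<bar>W * S\<bar> = 2 * c\<^sup>2" "c \<noteq> 0" "\<bar>W * S\<bar> \<le> 900"
  shows "t = 1 \<and> (W = 1 \<and> S = 2 \<or> W = - 1 \<and> S = - 2 \<or> W = 2 \<and> S = - 1 \<or> W = - 2 \<and> S = 1)"
proof -
  have nz: "W \<noteq> 0" "S \<noteq> 0" using WS(1,2) by auto
  consider "W > 0" "S > 0" | "W < 0" "S < 0" | "W < 0" "S > 0" | "W > 0" "S < 0"
    using nz by linarith
  then show ?thesis
  proof cases
    case 1
    then show ?thesis using pell_double_square_pos[OF t, of W S c] norm WS by (simp add: abs_mult)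
  next
    case 2
    then show ?thesis using pell_double_square_pos[OF t, of "- W" "- S" c] norm WS
      by (auto simp: abs_mult)
  next
    case 3
    have "\<bar>S\<^sup>2 + t * S * (- W) - (- W)\<^sup>2\<bar> = 1" using norm by (simp add: abs_if algebra_simps split: if_splits)
    then show ?thesis using pell_double_square_pos[OF t, of S "- W" c] 3 WS
      by (auto simp: abs_mult algebra_simps)
  next
    case 4
    have "\<bar>(- S)\<^sup>2 + t * (- S) * W - W\<^sup>2\<bar> = 1" using norm by (simp add: abs_if algebra_simps split: if_splits)
    then show ?thesis using pell_double_square_pos[OF t, of "- S" W c] 4 WS
      by (auto simp: abs_mult algebra_simps)
  qed
qed

section \<open>The Pell equation over the Gaussian integers\<close>

context quartic_root
begin

lemma t_pos: "int t \<ge> 1"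
  using t_odd by (cases t) auto

text \<open>Completing the square turns four times the form into (2a + tb)^2 - (t^2 + 4)b^2; a
  nontrivial zero would make t^2 + 4 a rational square.\<close>

lemma norm_form_zero:
  fixes a b :: int
  assumes "a\<^sup>2 + int t * a * b - b\<^sup>2 = 0"
  shows "a = 0" "b = 0"
proof -
  show "b = 0"
  proof (rule ccontr)
    assume b: "b \<noteq> 0"
    have "(2 * a + int t * b)\<^sup>2 - int (t\<^sup>2 + 4) * b\<^sup>2 = 4 * (a\<^sup>2 + int t * a * b - b\<^sup>2)"
      by (simp add: power2_eq_square algebra_simps)
    then have "of_int ((2 * a + int t * b)\<^sup>2) = (of_int (int (t\<^sup>2 + 4) * b\<^sup>2) :: real)"
      using assms by simp
    then have "(real_of_int (2 * a + int t * b))\<^sup>2 = real (t\<^sup>2 + 4) * (real_of_int b)\<^sup>2"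
      by (simp only: of_int_mult of_int_power of_int_of_nat_eq)
    then have "(real_of_int (2 * a + int t * b) / real_of_int b)\<^sup>2 = real (t\<^sup>2 + 4)"
      using b by (simp add: power_divide)
    moreover have "real_of_int (2 * a + int t * b) / real_of_int b \<in> \<rat>"
      by (intro Rats_divide Rats_of_int)
    ultimately show False using D_not_square by blast
  qed
  then show "a = 0" using assms by simp
qed

text \<open>Split \<open>p\<close> and \<open>q\<close> into real and imaginary parts \<open>v\<close>, \<open>w\<close> in \<open>\<int>\<^sup>2\<close>. For the indefinite form \<open>h\<close> with
  polar form \<open>B\<close> one has \<open>4 h(v) h(w) = (2 B(v,w))\<^sup>2 - (t\<^sup>2 + 4) det(v,w)\<^sup>2\<close>, and the value of the form
  is \<open>h(v) - h(w) + 2 B(v,w) \<i>\<close>.\<close>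

lemma gauss_pell_unit:
  assumes p: "p \<in> gauss_ints" and q: "q \<in> gauss_ints"
    and unit: "p\<^sup>2 + of_nat t * p * q - q\<^sup>2 \<in> gauss_units"
  obtains \<mu> W S where "\<mu> = 1 \<or> \<mu> = \<i>" "p = \<mu> * of_int W" "q = \<mu> * of_int S"
    "\<bar>W\<^sup>2 + int t * W * S - S\<^sup>2\<bar> = 1"
proof -
  obtain a c where pe: "p = of_int a + of_int c * \<i>" using p unfolding gauss_ints_def by blast
  obtain b d where qe: "q = of_int b + of_int d * \<i>" using q unfolding gauss_ints_def by blast
  define h k B D where "h = a\<^sup>2 + int t * a * b - b\<^sup>2" and "k = c\<^sup>2 + int t * c * d - d\<^sup>2"
    and "B = 2 * a * c + int t * (a * d + b * c) - 2 * b * d" and "D = a * d - b * c"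
  have val: "p\<^sup>2 + of_nat t * p * q - q\<^sup>2 = of_int (h - k) + of_int B * \<i>"
    unfolding pe qe h_def k_def B_def by (simp add: complex_eq_iff power2_eq_square algebra_simps)
  have form: "4 * h * k = B\<^sup>2 - ((int t)\<^sup>2 + 4) * D\<^sup>2"
    unfolding h_def k_def B_def D_def by (simp add: power2_eq_square algebra_simps)
  have "of_int (h - k) + of_int B * \<i> \<in> {1, -1, \<i>, -\<i>}"
    using unit unfolding val gauss_units_eq .
  then consider "\<bar>h - k\<bar> = 1" "B = 0" | "h = k" "\<bar>B\<bar> = 1"
    by (auto simp: complex_eq_iff)
  then show ?thesis
  proof cases
    case 1
    \<comment> \<open>With \<open>B = 0\<close> the product \<open>h * k\<close> is not positive,
      and two such integers at distance 1 include a 0. Anisotropy then removes the corresponding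
      part of both \<open>p\<close> and \<open>q\<close>.\<close>
    have "((int t)\<^sup>2 + 4) * D\<^sup>2 \<ge> 0" by simp
    moreover have "4 * (h * k) = - (((int t)\<^sup>2 + 4) * D\<^sup>2)" using form 1(2) by (simp add: mult.assoc)
    ultimately have "h * k \<le> 0" by linarith
    then have "h = 0 \<or> k = 0" using 1(1)
      by (auto simp: mult_le_0_iff abs_if split: if_splits)
    then show ?thesis
    proof
      assume h: "h = 0"
      then have "a = 0" "b = 0" using norm_form_zero unfolding h_def by blast+
      moreover have "\<bar>c\<^sup>2 + int t * c * d - d\<^sup>2\<bar> = 1" using 1(1) h by (simp add: k_def)
      ultimately show ?thesis using that[of \<i> c d] by (simp add: pe qe)
    next
      assume k: "k = 0"
      then have "c = 0" "d = 0" using norm_form_zero unfolding k_def by blast+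
      moreover have "\<bar>a\<^sup>2 + int t * a * b - b\<^sup>2\<bar> = 1" using 1(1) k by (simp add: h_def)
      ultimately show ?thesis using that[of 1 a b] by (simp add: pe qe)
    qed
  next
    case 2
    \<comment> \<open>The values \<i> and -\<i> do not occur: the identity forces
      \<open>D = 0\<close>, and \<open>4 * h\<^sup>2 = 1\<close> has no integer solution.\<close>
    have "B\<^sup>2 = 1" using 2(2) by (metis power2_abs one_power2)
    then have eq: "4 * h\<^sup>2 = 1 - ((int t)\<^sup>2 + 4) * D\<^sup>2" using form 2(1) by (simp add: power2_eq_square)
    have "D = 0"
    proof (rule ccontr)
      assume "D \<noteq> 0"
      then have "D\<^sup>2 \<ge> 1" by (simp add: int_one_le_iff_zero_less)
      then have "((int t)\<^sup>2 + 4) * D\<^sup>2 \<ge> 4 * 1" by (intro mult_mono) auto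
      then show False using eq zero_le_power2[of h] by linarith
    qed
    then have "4 * h\<^sup>2 = 1" using eq by simp
    then show ?thesis by presburger
  qed
qed

lemma index_form_units_imp:
  assumes xyz: "x \<in> gauss_ints" "y \<in> gauss_ints" "z \<in> gauss_ints" and bound: "cmod y \<le> 30"
    and N: "x\<^sup>2 + s * x * z + z\<^sup>2 \<in> gauss_units"
    and A: "(x + z * (s - 1))\<^sup>2 - y\<^sup>2 * (s - 2) \<in> gauss_units"
    and B: "(x + z * (s + 1))\<^sup>2 - y\<^sup>2 * (s + 2) \<in> gauss_units"
  shows "\<exists>u\<in>gauss_units. (x = u \<and> y = 0 \<and> z = 0) \<or> (x = u * (- s) \<and> y = 0 \<and> z = u) \<or>
    t = 1 \<and> (\<exists>h\<in>{1 + \<i>, - (1 + \<i>)}. (x = u * 3 \<and> y = u * h \<and> z = u * (2 * \<i>)) \<or>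
      (x = u * \<i> \<and> y = u * h \<and> z = u))"
proof -
  define w where "w = x + s * z"
  have w: "w \<in> gauss_ints" unfolding w_def by (intro gauss_ints_closed s_int xyz)
  have "z * w - y\<^sup>2 = 0"
  proof (rule gauss_ints_small)
    show "z * w - y\<^sup>2 \<in> gauss_ints" by (intro gauss_ints_closed xyz w)
    have u1: "cmod u = 1" if "u \<in> gauss_units" for u using that by (auto simp: gauss_units_eq)
    have "4 * (z * w - y\<^sup>2) = ((x + z * (s + 1))\<^sup>2 - y\<^sup>2 * (s + 2)) - ((x + z * (s - 1))\<^sup>2 - y\<^sup>2 * (s - 2))"
      by (simp add: w_def power2_eq_square algebra_simps)
    then have "cmod (4 * (z * w - y\<^sup>2)) \<le> 1 + 1"
      using norm_triangle_ineq4 u1[OF A] u1[OF B] by metis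
    moreover have "cmod (4 * (z * w - y\<^sup>2)) = 4 * cmod (z * w - y\<^sup>2)"
      by (simp only: norm_mult norm_numeral)
    ultimately show "cmod (z * w - y\<^sup>2) < 1" by linarith
  qed
  then have y2: "y\<^sup>2 = z * w" by simp
  have "w\<^sup>2 + of_nat t * w * (- \<i> * z) - (- \<i> * z)\<^sup>2 = x\<^sup>2 + s * x * z + z\<^sup>2"
    by (simp add: w_def s_def power2_eq_square algebra_simps)
  then have unit: "w\<^sup>2 + of_nat t * w * (- \<i> * z) - (- \<i> * z)\<^sup>2 \<in> gauss_units" using N by simp
  have iz: "- \<i> * z \<in> gauss_ints" by (intro gauss_ints_closed xyz)
  from gauss_pell_unit[OF w iz unit]
  obtain \<mu> W S where \<mu>: "\<mu> = 1 \<or> \<mu> = \<i>" and wz: "w = \<mu> * of_int W" "- \<i> * z = \<mu> * of_int S"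
    and norm: "\<bar>W\<^sup>2 + int t * W * S - S\<^sup>2\<bar> = 1" by blast
  have z: "z = \<i> * \<mu> * of_int S"
  proof -
    have "z = \<i> * (- \<i> * z)" by simp
    then show ?thesis unfolding wz(2) by simp
  qed
  have x: "x = w - s * z" by (simp add: w_def)
  have \<mu>u: "\<mu> \<in> gauss_units" "- \<mu> \<in> gauss_units" "\<i> * \<mu> \<in> gauss_units" "- (\<i> * \<mu>) \<in> gauss_units"
    using \<mu> by (auto simp: gauss_units_eq)
  have y2': "y\<^sup>2 = \<i> * \<mu>\<^sup>2 * of_int (W * S)" unfolding y2 z wz(1) by (simp add: power2_eq_square)
  obtain c d where y: "y = of_int c + of_int d * \<i>" using xyz(2) unfolding gauss_ints_def by blast
  \<comment> \<open>\<open>\<mu>\<^sup>2\<close> is 1 or -1, so \<open>y\<^sup>2\<close> is purely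
    imaginary and the coordinates of \<open>y\<close> agree up to sign. Hence |WS| = |y|^2 is twice
    a square.\<close>
  have "Re (y\<^sup>2) = 0" unfolding y2' using \<mu> by auto
  then have "of_int (c\<^sup>2) = (of_int (d\<^sup>2) :: real)" by (simp add: y Re_power2)
  then have cd: "d\<^sup>2 = c\<^sup>2" by (simp only: of_int_eq_iff)
  have n2: "(cmod y)\<^sup>2 = of_int (2 * c\<^sup>2)"
    unfolding y by (simp add: cmod_power2 flip: of_int_power) (simp add: cd)
  have "cmod (y\<^sup>2) = of_int \<bar>W * S\<bar>" unfolding y2' using \<mu> by (auto simp: norm_mult norm_power abs_mult)
  then have "of_int \<bar>W * S\<bar> = (of_int (2 * c\<^sup>2) :: real)" using n2 by (simp add: norm_power)
  then have WS: "\<bar>W * S\<bar> = 2 * c\<^sup>2" by (simp only: of_int_eq_iff)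
  have "(cmod y)\<^sup>2 \<le> 30\<^sup>2" using bound by (intro power_mono) auto
  then have "of_int (2 * c\<^sup>2) \<le> (of_int 900 :: real)" using n2 by simp
  then have "2 * c\<^sup>2 \<le> 900" by (simp only: of_int_le_iff)
  then have WS900: "\<bar>W * S\<bar> \<le> 900" using WS by simp
  show ?thesis
  proof (cases "c = 0")
    case True
    then have y0: "y = 0" using cd by (simp add: y)
    have "W * S = 0" using True WS by simp
    \<comment> \<open>The trivial solutions: \<open>S = 0\<close> yields unit multiples of \<xi>,
      and \<open>W = 0\<close> those of -s\<xi> + \<xi>^3.\<close>
    then consider "S = 0" "\<bar>W\<bar> = 1" | "W = 0" "\<bar>S\<bar> = 1"
      using norm by (auto simp: abs_square_eq_1)
    then show ?thesis
    proof cases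
      case 1
      then have "x \<in> gauss_units" "z = 0"
        using \<mu>u x wz z by (auto simp: abs_if split: if_splits)
      then show ?thesis using y0 by blast
    next
      case 2
      then have "z \<in> gauss_units" "x = z * (- s)"
        using \<mu>u x wz z by (auto simp: abs_if split: if_splits)
      then show ?thesis using y0 by blast
    qed
  next
    case False
    have cases: "t = 1 \<and> (W = 1 \<and> S = 2 \<or> W = - 1 \<and> S = - 2 \<or> W = 2 \<and> S = - 1 \<or> W = - 2 \<and> S = 1)"
      using pell_double_square[OF t_pos _ norm WS False WS900] t_odd by simp
    then have t1: "t = 1" by simp
    then have s1: "s = \<i>" unfolding s_def by simp
    \<comment> \<open>In all four cases \<open>z * w\<close> is \<open>2 * \<i> * u\<^sup>2\<close>
      for a unit \<open>u\<close>, and 2\<i> is the square of 1 + \<i>; this is the origin of the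
      middle coefficients of the exceptional generators.\<close>
    have sq: "y = u * (1 + \<i>) \<or> y = u * (- (1 + \<i>))" if "y\<^sup>2 = 2 * \<i> * u\<^sup>2" for u
    proof -
      have "y\<^sup>2 = (u * (1 + \<i>))\<^sup>2" unfolding that by (simp add: power2_eq_square algebra_simps)
      then show ?thesis by (metis mult_minus_right power2_eq_iff)
    qed
    have first: ?thesis if u: "u \<in> gauss_units" "w = u" "z = 2 * \<i> * u" for u
    proof -
      have "y\<^sup>2 = 2 * \<i> * u\<^sup>2" unfolding y2 u(2,3) by (simp add: power2_eq_square)
      moreover have "x = u * 3" unfolding x u(2,3) s1 by simp
      ultimately show ?thesis using sq[of u] t1 u by (intro bexI[of _ u]) auto
    qed
    have second: ?thesis if u: "u \<in> gauss_units" "w = 2 * \<i> * u" "z = u" for u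
    proof -
      have "y\<^sup>2 = 2 * \<i> * u\<^sup>2" unfolding y2 u(2,3) by (simp add: power2_eq_square)
      moreover have "x = u * \<i>" unfolding x u(2,3) s1 by simp
      ultimately show ?thesis using sq[of u] t1 u by (intro bexI[of _ u]) auto
    qed
    from cases consider "W = 1" "S = 2" | "W = - 1" "S = - 2" | "W = 2" "S = - 1" | "W = - 2" "S = 1"
      by blast
    then show ?thesis
    proof cases
      case 1
      then show ?thesis using first[of \<mu>] \<mu>u wz z by simp
    next
      case 2
      then show ?thesis using first[of "- \<mu>"] \<mu>u wz z by simp
    next
      case 3
      then show ?thesis using second[of "- (\<i> * \<mu>)"] \<mu>u wz z by simp
    next
      case 4
      then show ?thesis using second[of "\<i> * \<mu>"] \<mu>u wz z by simp
    qed
  qed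
qed

section \<open>Generators\<close>

abbreviation "OK \<equiv> cubic_span gauss_ints \<xi>"

lemma is_subring_OK: "is_subring OK"
  by (rule is_subring_cubic_span[OF is_subring_gauss_ints s_int root_\<xi>])

lemma OK_add [intro]: "a \<in> OK \<Longrightarrow> b \<in> OK \<Longrightarrow> a + b \<in> OK"
  and OK_diff [intro]: "a \<in> OK \<Longrightarrow> b \<in> OK \<Longrightarrow> a - b \<in> OK"
  and OK_mult [intro]: "a \<in> OK \<Longrightarrow> b \<in> OK \<Longrightarrow> a * b \<in> OK"
  and OK_gauss_ints: "a \<in> gauss_ints \<Longrightarrow> a \<in> OK"
  and OK_\<xi> [intro]: "\<xi> \<in> OK"
  using is_subring_OK cubic_span_base[OF is_subring_gauss_ints, of \<xi>] by (auto simp: is_subring_def)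

lemma OK_\<zeta>: "\<zeta> \<in> OK"
  by (rule cubic_spanI[of 0 _ s 0 "- 1"]) (auto simp: \<zeta>_def cubic_def)

lemma OK_cubic:
  assumes "a \<in> gauss_ints" "b \<in> gauss_ints" "c \<in> gauss_ints" "d \<in> gauss_ints" "X \<in> OK"
  shows "cubic a b c d X \<in> OK"
  using assms OK_gauss_ints unfolding cubic_def power2_eq_square power3_eq_cube by (intro OK_add OK_mult) auto

lemma gauss_ints_cubic_eq_iff:
  assumes "is_root X"
    and "a0 \<in> gauss_ints" "a1 \<in> gauss_ints" "a2 \<in> gauss_ints" "a3 \<in> gauss_ints"
    and "b0 \<in> gauss_ints" "b1 \<in> gauss_ints" "b2 \<in> gauss_ints" "b3 \<in> gauss_ints"
  shows "cubic a0 a1 a2 a3 X = cubic b0 b1 b2 b3 X \<longleftrightarrow> a0 = b0 \<and> a1 = b1 \<and> a2 = b2 \<and> a3 = b3"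
  using assms by (intro cubic_eq_iff gauss_ints_imp_rats)

text \<open>If \<open>\<xi>\<close> is a polynomial in \<open>\<alpha>\<close>, then a difference of conjugates of \<open>\<alpha>\<close> divides the corresponding
  difference of conjugates of \<open>\<xi>\<close>. All conjugates lie in the same ring, since the conjugates of \<open>\<xi>\<close>
  are \<open>\<plusminus>\<xi>\<close> and \<open>\<plusminus>1/\<xi>\<close>.\<close>

lemma conjugate_difference_dvd:
  assumes xyz: "x \<in> gauss_ints" "y \<in> gauss_ints" "z \<in> gauss_ints"
    and gen: "\<xi> \<in> adjoin_ring gauss_ints (cubic 0 x y z \<xi>)"
    and X: "is_root X" "X \<in> OK" and Y: "is_root Y" "Y \<in> OK"
  shows "\<exists>q\<in>OK. X - Y = (cubic 0 x y z X - cubic 0 x y z Y) * q"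
proof -
  define \<delta> where "\<delta> = cubic 0 x y z X - cubic 0 x y z Y"
  \<comment> \<open>\<open>T\<close> collects the elements whose conjugates at \<open>X\<close> and
    \<open>Y\<close> differ by a multiple of \<open>\<delta>\<close>. It is a ring by the product
    rule for differences and contains the generator, hence \<xi>.\<close>
  define T where "T = {v. \<exists>a\<in>gauss_ints. \<exists>b\<in>gauss_ints. \<exists>c\<in>gauss_ints. \<exists>d\<in>gauss_ints. \<exists>q\<in>OK.
    v = cubic a b c d \<xi> \<and> cubic a b c d X - cubic a b c d Y = \<delta> * q}"
  have TI: "v \<in> T" if "a \<in> gauss_ints" "b \<in> gauss_ints" "c \<in> gauss_ints" "d \<in> gauss_ints" "q \<in> OK"
    "v = cubic a b c d \<xi>" "cubic a b c d X - cubic a b c d Y = \<delta> * q" for v a b c d q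
    unfolding T_def using that by blast
  have const: "v \<in> T" if "v \<in> gauss_ints" for v
    by (rule TI[of v 0 0 0 0]) (use that OK_gauss_ints in \<open>auto simp: cubic_def\<close>)
  have "is_subring T"
    unfolding is_subring_def
  proof (intro conjI ballI)
    fix v v' assume "v \<in> T" and v': "v' \<in> T"
    from \<open>v \<in> T\<close> obtain a0 a1 a2 a3 q where a: "a0 \<in> gauss_ints" "a1 \<in> gauss_ints" "a2 \<in> gauss_ints"
      "a3 \<in> gauss_ints" and q: "q \<in> OK" "v = cubic a0 a1 a2 a3 \<xi>"
      "cubic a0 a1 a2 a3 X - cubic a0 a1 a2 a3 Y = \<delta> * q" unfolding T_def by blast
    from v' obtain b0 b1 b2 b3 q' where b: "b0 \<in> gauss_ints" "b1 \<in> gauss_ints" "b2 \<in> gauss_ints"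
      "b3 \<in> gauss_ints" and q': "q' \<in> OK" "v' = cubic b0 b1 b2 b3 \<xi>"
      "cubic b0 b1 b2 b3 X - cubic b0 b1 b2 b3 Y = \<delta> * q'" unfolding T_def by blast
    show "v + v' \<in> T"
      by (rule TI[of "a0 + b0" "a1 + b1" "a2 + b2" "a3 + b3" "q + q'"])
        (use a b q q' in \<open>auto simp flip: cubic_add simp: algebra_simps\<close>)
    show "v - v' \<in> T"
      by (rule TI[of "a0 - b0" "a1 - b1" "a2 - b2" "a3 - b3" "q - q'"])
        (use a b q q' in \<open>auto simp flip: cubic_diff simp: algebra_simps\<close>)
    show "v * v' \<in> T"
    proof (rule TI[OF _ _ _ _ _ _ ])
      let ?q = "q * cubic b0 b1 b2 b3 X + cubic a0 a1 a2 a3 Y * q'"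
      show "?q \<in> OK" by (intro OK_add OK_mult OK_cubic a b q(1) q'(1) X(2) Y(2))
      show "v * v' = cubic (a0 * b0 - (a1 * b3 + a2 * b2 + a3 * b1) - s * (a3 * b3))
            (a0 * b1 + a1 * b0 - (a2 * b3 + a3 * b2))
            (a0 * b2 + a1 * b1 + a2 * b0 + s * (a1 * b3 + a2 * b2 + a3 * b1) + (s\<^sup>2 - 1) * (a3 * b3))
            (a0 * b3 + a1 * b2 + a2 * b1 + a3 * b0 + s * (a2 * b3 + a3 * b2)) \<xi>"
        unfolding q(2) q'(2) by (rule cubic_mult[OF root_\<xi>])
      have "cubic a0 a1 a2 a3 X * cubic b0 b1 b2 b3 X - cubic a0 a1 a2 a3 Y * cubic b0 b1 b2 b3 Y
        = (cubic a0 a1 a2 a3 X - cubic a0 a1 a2 a3 Y) * cubic b0 b1 b2 b3 X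
          + cubic a0 a1 a2 a3 Y * (cubic b0 b1 b2 b3 X - cubic b0 b1 b2 b3 Y)"
        by (simp add: algebra_simps)
      also have "\<dots> = \<delta> * ?q" unfolding q(3) q'(3) by (simp add: algebra_simps)
      finally show "cubic (a0 * b0 - (a1 * b3 + a2 * b2 + a3 * b1) - s * (a3 * b3))
            (a0 * b1 + a1 * b0 - (a2 * b3 + a3 * b2))
            (a0 * b2 + a1 * b1 + a2 * b0 + s * (a1 * b3 + a2 * b2 + a3 * b1) + (s\<^sup>2 - 1) * (a3 * b3))
            (a0 * b3 + a1 * b2 + a2 * b1 + a3 * b0 + s * (a2 * b3 + a3 * b2)) X -
          cubic (a0 * b0 - (a1 * b3 + a2 * b2 + a3 * b1) - s * (a3 * b3))
            (a0 * b1 + a1 * b0 - (a2 * b3 + a3 * b2))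
            (a0 * b2 + a1 * b1 + a2 * b0 + s * (a1 * b3 + a2 * b2 + a3 * b1) + (s\<^sup>2 - 1) * (a3 * b3))
            (a0 * b3 + a1 * b2 + a2 * b1 + a3 * b0 + s * (a2 * b3 + a3 * b2)) Y = \<delta> * ?q"
        unfolding cubic_mult[OF X(1)] cubic_mult[OF Y(1)] .
    qed (intro gauss_ints_closed a b s_int)+
  qed (auto intro: const)
  moreover have "cubic 0 x y z \<xi> \<in> T"
    by (rule TI[of 0 x y z 1]) (use xyz OK_gauss_ints in \<open>auto simp: \<delta>_def\<close>)
  ultimately have "adjoin_ring gauss_ints (cubic 0 x y z \<xi>) \<subseteq> T"
    using const by (intro adjoin_ring_subset) auto
  then have "\<xi> \<in> T" using gen by blast
  then obtain a b c d q where abcd: "a \<in> gauss_ints" "b \<in> gauss_ints" "c \<in> gauss_ints" "d \<in> gauss_ints"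
    and q: "q \<in> OK" "\<xi> = cubic a b c d \<xi>" "cubic a b c d X - cubic a b c d Y = \<delta> * q"
    unfolding T_def by blast
  have "cubic a b c d \<xi> = cubic 0 1 0 0 \<xi>" using q(2) by (simp add: cubic_def)
  then have "a = 0 \<and> b = 1 \<and> c = 0 \<and> d = 0"
    by (subst (asm) gauss_ints_cubic_eq_iff[OF root_\<xi>]) (use abcd in auto)
  then have "X - Y = \<delta> * q" using q(3) by (simp add: cubic_def)
  then show ?thesis using q(1) unfolding \<delta>_def by blast
qed

text \<open>By independence, the constant coordinate of \<open>q\<close> is already an inverse of
  \<open>N\<close>.\<close>

lemma gauss_unit_of_OK_unit:
  assumes N: "N \<in> gauss_ints" and q: "q \<in> OK" "N * q = 1"
  shows "N \<in> gauss_units"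
proof -
  obtain a b c d where abcd: "a \<in> gauss_ints" "b \<in> gauss_ints" "c \<in> gauss_ints" "d \<in> gauss_ints"
    and qe: "q = cubic a b c d \<xi>" using q(1) by (rule cubic_spanE)
  have "cubic (N * a) (N * b) (N * c) (N * d) \<xi> = cubic 1 0 0 0 \<xi>"
    using q(2) unfolding qe cubic_scale by (simp add: cubic_def)
  then have "N * a = 1"
    by (subst (asm) gauss_ints_cubic_eq_iff[OF root_\<xi>]) (use abcd N in auto)
  then show ?thesis using N abcd(1) unfolding gauss_units_def by blast
qed

text \<open>Each factor belongs to one splitting of the four conjugates into two pairs: \<xi> with
  -\<xi>, \<xi> with -\<zeta>, \<xi> with \<zeta>. The two difference quotients of a splitting are
  units of the ring, and their product is a Gaussian integer.\<close>

lemma generator_index_form_units: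
  assumes xyz: "x \<in> gauss_ints" "y \<in> gauss_ints" "z \<in> gauss_ints"
    and gen: "\<xi> \<in> adjoin_ring gauss_ints (cubic 0 x y z \<xi>)"
  shows "x\<^sup>2 + s * x * z + z\<^sup>2 \<in> gauss_units"
    and "(x + z * (s - 1))\<^sup>2 - y\<^sup>2 * (s - 2) \<in> gauss_units"
    and "(x + z * (s + 1))\<^sup>2 - y\<^sup>2 * (s + 2) \<in> gauss_units"
proof -
  have uminus: "- X \<in> OK" if "X \<in> OK" for X
    using OK_diff[OF OK_gauss_ints[OF gauss_ints_zero] that] by simp
  note conj = root_\<xi> OK_\<xi> root_\<zeta> OK_\<zeta> root_uminus[OF root_\<xi>] uminus[OF OK_\<xi>]
    root_uminus[OF root_\<zeta>] uminus[OF OK_\<zeta>]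
  note dvd = conjugate_difference_dvd[OF xyz gen]
  have s2: "s - 2 \<noteq> 0" "s + 2 \<noteq> 0" by (auto simp: s_def complex_eq_iff)
  have "(\<xi> - \<zeta>)\<^sup>2 = s - 2" "(\<xi> + \<zeta>)\<^sup>2 = s + 2"
    using \<xi>_\<zeta> \<xi>_\<zeta>_squares by Groebner_Basis.algebra+
  then have nz: "\<xi> - \<zeta> \<noteq> 0" "\<xi> + \<zeta> \<noteq> 0" using s2 by auto

  obtain q1 where q1: "q1 \<in> OK" "\<xi> - (- \<xi>) = (cubic 0 x y z \<xi> - cubic 0 x y z (- \<xi>)) * q1"
    using dvd[OF conj(1,2,5,6)] by blast
  obtain q2 where q2: "q2 \<in> OK" "\<zeta> - (- \<zeta>) = (cubic 0 x y z \<zeta> - cubic 0 x y z (- \<zeta>)) * q2"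
    using dvd[OF conj(3,4,7,8)] by blast
  have "2 * \<xi> * 1 = 2 * \<xi> * ((x + z * \<xi>\<^sup>2) * q1)"
    using q1(2) unfolding cubic_def by Groebner_Basis.algebra
  then have 1: "(x + z * \<xi>\<^sup>2) * q1 = 1" using root_nonzero[OF root_\<xi>] by simp
  have "2 * \<zeta> * 1 = 2 * \<zeta> * ((x + z * \<zeta>\<^sup>2) * q2)"
    using q2(2) unfolding cubic_def by Groebner_Basis.algebra
  then have 2: "(x + z * \<zeta>\<^sup>2) * q2 = 1" using root_nonzero[OF root_\<zeta>] by simp
  have "(x\<^sup>2 + s * x * z + z\<^sup>2) * (q1 * q2) = 1"
    using 1 2 \<xi>_\<zeta> \<xi>_\<zeta>_squares by Groebner_Basis.algebra
  then show "x\<^sup>2 + s * x * z + z\<^sup>2 \<in> gauss_units"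
    using q1(1) q2(1) xyz by (intro gauss_unit_of_OK_unit[of _ "q1 * q2"] gauss_ints_closed s_int) auto

  obtain q3 where q3: "q3 \<in> OK" "\<xi> - (- \<zeta>) = (cubic 0 x y z \<xi> - cubic 0 x y z (- \<zeta>)) * q3"
    using dvd[OF conj(1,2,7,8)] by blast
  obtain q4 where q4: "q4 \<in> OK" "- \<xi> - \<zeta> = (cubic 0 x y z (- \<xi>) - cubic 0 x y z \<zeta>) * q4"
    using dvd[OF conj(5,6,3,4)] by blast
  have "(\<xi> + \<zeta>) * ((x + z * (s - 1) + y * (\<xi> - \<zeta>)) * q3) = \<xi> + \<zeta>"
    using q3(2) \<xi>_\<zeta> \<xi>_\<zeta>_squares unfolding cubic_def by Groebner_Basis.algebra
  then have 3: "(x + z * (s - 1) + y * (\<xi> - \<zeta>)) * q3 = 1" using nz(2) by simp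
  have "(\<xi> + \<zeta>) * ((x + z * (s - 1) - y * (\<xi> - \<zeta>)) * q4) = \<xi> + \<zeta>"
    using q4(2) \<xi>_\<zeta> \<xi>_\<zeta>_squares unfolding cubic_def by Groebner_Basis.algebra
  then have 4: "(x + z * (s - 1) - y * (\<xi> - \<zeta>)) * q4 = 1" using nz(2) by simp
  have "((x + z * (s - 1))\<^sup>2 - y\<^sup>2 * (s - 2)) * (q3 * q4)
      = ((x + z * (s - 1) + y * (\<xi> - \<zeta>)) * q3) * ((x + z * (s - 1) - y * (\<xi> - \<zeta>)) * q4)"
    unfolding \<open>(\<xi> - \<zeta>)\<^sup>2 = s - 2\<close>[symmetric] by (simp add: power2_eq_square algebra_simps)
  also have "\<dots> = 1" unfolding 3 4 by simp
  finally show "(x + z * (s - 1))\<^sup>2 - y\<^sup>2 * (s - 2) \<in> gauss_units"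
    using q3(1) q4(1) xyz by (intro gauss_unit_of_OK_unit[of _ "q3 * q4"] gauss_ints_closed s_int) auto

  obtain q5 where q5: "q5 \<in> OK" "\<xi> - \<zeta> = (cubic 0 x y z \<xi> - cubic 0 x y z \<zeta>) * q5"
    using dvd[OF conj(1,2,3,4)] by blast
  obtain q6 where q6: "q6 \<in> OK" "- \<xi> - (- \<zeta>) = (cubic 0 x y z (- \<xi>) - cubic 0 x y z (- \<zeta>)) * q6"
    using dvd[OF conj(5,6,7,8)] by blast
  have "(\<xi> - \<zeta>) * ((x + z * (s + 1) + y * (\<xi> + \<zeta>)) * q5) = \<xi> - \<zeta>"
    using q5(2) \<xi>_\<zeta> \<xi>_\<zeta>_squares unfolding cubic_def by Groebner_Basis.algebra
  then have 5: "(x + z * (s + 1) + y * (\<xi> + \<zeta>)) * q5 = 1" using nz(1) by simp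
  have "(\<xi> - \<zeta>) * ((x + z * (s + 1) - y * (\<xi> + \<zeta>)) * q6) = \<xi> - \<zeta>"
    using q6(2) \<xi>_\<zeta> \<xi>_\<zeta>_squares unfolding cubic_def by Groebner_Basis.algebra
  then have 6: "(x + z * (s + 1) - y * (\<xi> + \<zeta>)) * q6 = 1" using nz(1) by simp
  have "((x + z * (s + 1))\<^sup>2 - y\<^sup>2 * (s + 2)) * (q5 * q6)
      = ((x + z * (s + 1) + y * (\<xi> + \<zeta>)) * q5) * ((x + z * (s + 1) - y * (\<xi> + \<zeta>)) * q6)"
    unfolding \<open>(\<xi> + \<zeta>)\<^sup>2 = s + 2\<close>[symmetric] by (simp add: power2_eq_square algebra_simps)
  also have "\<dots> = 1" unfolding 5 6 by simp
  finally show "(x + z * (s + 1))\<^sup>2 - y\<^sup>2 * (s + 2) \<in> gauss_units"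
    using q5(1) q6(1) xyz by (intro gauss_unit_of_OK_unit[of _ "q5 * q6"] gauss_ints_closed s_int) auto
qed

lemma generates_rel_pibI:
  assumes \<beta>: "\<beta> \<in> OK" and c: "c0 \<in> gauss_ints" "c1 \<in> gauss_ints" "c2 \<in> gauss_ints" "c3 \<in> gauss_ints"
    and eq: "\<xi> = cubic c0 c1 c2 c3 \<beta>"
  shows "generates_rel_pib OK \<beta>"
proof -
  let ?A = "adjoin_ring gauss_ints \<beta>"
  have "\<xi> \<in> cubic_span gauss_ints \<beta>" by (rule cubic_spanI[OF c eq])
  then have "\<xi> \<in> ?A" using cubic_span_subset[OF is_subring_adjoin_ring adjoin_ring_base] by blast
  then have "OK \<subseteq> ?A" using adjoin_ring_base[of \<beta> gauss_ints]
    by (intro cubic_span_subset is_subring_adjoin_ring) auto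
  moreover have "?A \<subseteq> OK" using \<beta> OK_gauss_ints by (intro adjoin_ring_subset is_subring_OK) auto
  ultimately show ?thesis unfolding generates_rel_pib_def by blast
qed

section \<open>The listed generators and their equivalence\<close>

definition generator_coords :: "(complex \<times> complex \<times> complex) set" where
  "generator_coords = {(1, 0, 0), (- s, 0, 1)} \<union>
     (if t = 1 then {(3, 1 + \<i>, 2 * \<i>), (3, - (1 + \<i>), 2 * \<i>), (\<i>, 1 + \<i>, 1), (\<i>, - (1 + \<i>), 1)} else {})"

lemma generator_coords_gauss_ints:
  assumes "(a, b, c) \<in> generator_coords"
  shows "a \<in> gauss_ints" "b \<in> gauss_ints" "c \<in> gauss_ints"
  using assms gauss_ints_minus[OF s_int] by (auto simp: generator_coords_def split: if_splits)

text \<open>For \<open>t = 1\<close>, the coefficients expressing \<open>\<xi>\<close> as a cubic polynomial in the generator come from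
  inverting the matrix of its powers.\<close>

lemma generator_coords_generate:
  assumes "(a, b, c) \<in> generator_coords"
  shows "generates_rel_pib OK (cubic 0 a b c \<xi>)"
proof -
  note abc = generator_coords_gauss_ints[OF assms]
  have OK: "cubic 0 a b c \<xi> \<in> OK" using abc by (intro OK_cubic OK_\<xi>) auto
  have r: "\<xi> ^ 4 = s * \<xi>\<^sup>2 - 1" using root_\<xi> by (simp add: is_root_def)
  \<comment> \<open>Retaining only \<open>h\<^sup>2 = 2 * \<i>\<close> treats both signs of the
    middle coefficient at once.\<close>
  consider "(a, b, c) = (1, 0, 0)" | "(a, b, c) = (- s, 0, 1)"
    | h where "t = 1" "h\<^sup>2 = 2 * \<i>" "(a, b, c) = (3, h, 2 * \<i>)" "h \<in> gauss_ints"
    | h where "t = 1" "h\<^sup>2 = 2 * \<i>" "(a, b, c) = (\<i>, h, 1)" "h \<in> gauss_ints"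
  proof -
    have "(1 + \<i>)\<^sup>2 = 2 * \<i>" "(- (1 + \<i>))\<^sup>2 = 2 * \<i>" by (simp_all add: power2_eq_square algebra_simps)
    moreover have "1 + \<i> \<in> gauss_ints" "- (1 + \<i>) \<in> gauss_ints" by (intro gauss_ints_closed)+
    ultimately show ?thesis
      using assms that unfolding generator_coords_def by (auto split: if_splits)
  qed
  then show ?thesis
  proof cases
    case 1
    show ?thesis by (rule generates_rel_pibI[OF OK, of 0 1 0 0]) (use 1 in \<open>auto simp: cubic_def\<close>)
  next
    case 2
    have "\<xi> = cubic 0 (- s) 0 1 (cubic 0 a b c \<xi>)"
    proof -
      \<comment> \<open>Since \<zeta> is a root of the same quartic with inverse \<xi>, the formula
        for \<zeta> in terms of \<xi> also gives \<xi> in terms of \<zeta>.\<close>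
      have "cubic 0 a b c \<xi> = - \<zeta>" using 2 by (simp add: cubic_def \<zeta>_def)
      moreover have "\<xi> = s * \<zeta> - \<zeta> ^ 3"
        using \<xi>_\<zeta> \<xi>_\<zeta>_squares by Groebner_Basis.algebra
      ultimately show ?thesis by (simp add: cubic_def)
    qed
    then show ?thesis by (rule generates_rel_pibI[OF OK, rotated 4]) auto
  next
    case (3 h)
    define \<alpha> where "\<alpha> = cubic 0 a b c \<xi>"
    have s: "s = \<i>" using 3(1) unfolding s_def by simp
    have ii: "\<i>\<^sup>2 = - 1" by simp
    have \<alpha>: "\<alpha> = 3 * \<xi> + h * \<xi>\<^sup>2 + 2 * \<i> * \<xi> ^ 3" using 3(3) by (simp add: \<alpha>_def cubic_def)
    have a2: "\<alpha>\<^sup>2 = - 10 * \<i> - 4 * \<i> * h * \<xi> + 3 * \<xi>\<^sup>2 + 2 * h * \<xi> ^ 3"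
      using r 3(2) ii unfolding \<alpha> s by Groebner_Basis.algebra
    have a3: "\<alpha> ^ 3 = - 13 * h - 40 * \<i> * \<xi> - 13 * \<i> * h * \<xi>\<^sup>2 + 27 * \<xi> ^ 3"
    proof -
      have "\<alpha> ^ 3 = \<alpha> * \<alpha>\<^sup>2" by (simp add: power2_eq_square power3_eq_cube)
      then show ?thesis using r 3(2) ii unfolding a2 unfolding \<alpha> s by Groebner_Basis.algebra
    qed
    have "\<xi> = cubic (36 * \<i> * h) (- 29) h (2 * \<i>) \<alpha>"
      unfolding cubic_def a2 a3 using 3(2) ii unfolding \<alpha> by Groebner_Basis.algebra
    then show ?thesis unfolding \<alpha>_def using 3(4)
      by (intro generates_rel_pibI[OF OK, of "36 * \<i> * h" "- 29" h "2 * \<i>"] gauss_ints_closed)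
  next
    case (4 h)
    define \<alpha> where "\<alpha> = cubic 0 a b c \<xi>"
    have s: "s = \<i>" using 4(1) unfolding s_def by simp
    have ii: "\<i>\<^sup>2 = - 1" by simp
    have \<alpha>: "\<alpha> = \<i> * \<xi> + h * \<xi>\<^sup>2 + \<xi> ^ 3" using 4(3) by (simp add: \<alpha>_def cubic_def)
    have a2: "\<alpha>\<^sup>2 = - 5 * \<i> - 2 * h * \<xi> - 7 * \<xi>\<^sup>2 + 4 * \<i> * h * \<xi> ^ 3"
      using r 4(2) ii unfolding \<alpha> s by Groebner_Basis.algebra
    have a3: "\<alpha> ^ 3 = 17 * h + 20 * \<xi> - 28 * \<i> * h * \<xi>\<^sup>2 - 31 * \<i> * \<xi> ^ 3"
    proof -
      have "\<alpha> ^ 3 = \<alpha> * \<alpha>\<^sup>2" by (simp add: power2_eq_square power3_eq_cube)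
      then show ?thesis using r 4(2) ii unfolding a2 unfolding \<alpha> s by Groebner_Basis.algebra
    qed
    have "\<xi> = cubic (- 2 * h) (7 * \<i>) (- 3 * \<i> * h) 1 \<alpha>"
      unfolding cubic_def a2 a3 using 4(2) ii unfolding \<alpha> by Groebner_Basis.algebra
    then show ?thesis unfolding \<alpha>_def using 4(4)
      by (intro generates_rel_pibI[OF OK, of "- 2 * h" "7 * \<i>" "- 3 * \<i> * h" 1] gauss_ints_closed)
  qed
qed

text \<open>Both constant terms are 0, so independence forces the translation to vanish.\<close>

lemma rel_equivalent_cubic:
  assumes "a \<in> gauss_ints" "b \<in> gauss_ints" "c \<in> gauss_ints"
    and "a' \<in> gauss_ints" "b' \<in> gauss_ints" "c' \<in> gauss_ints"
  shows "rel_equivalent (cubic 0 a b c \<xi>) (cubic 0 a' b' c' \<xi>) \<longleftrightarrow>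
    (\<exists>u\<in>gauss_units. a = u * a' \<and> b = u * b' \<and> c = u * c')"
proof
  assume "rel_equivalent (cubic 0 a b c \<xi>) (cubic 0 a' b' c' \<xi>)"
  then obtain u d where u: "u \<in> gauss_units" and d: "d \<in> gauss_ints"
    and "cubic 0 a b c \<xi> = u * cubic 0 a' b' c' \<xi> + d" unfolding rel_equivalent_def by blast
  then have "cubic 0 a b c \<xi> = cubic d (u * a') (u * b') (u * c') \<xi>"
    by (simp add: cubic_def algebra_simps)
  moreover have "u \<in> gauss_ints" using u by (simp add: gauss_units_def)
  ultimately have "a = u * a' \<and> b = u * b' \<and> c = u * c'"
    by (subst (asm) gauss_ints_cubic_eq_iff[OF root_\<xi>]) (use assms d in auto)
  then show "\<exists>u\<in>gauss_units. a = u * a' \<and> b = u * b' \<and> c = u * c'" using u by blast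
next
  assume "\<exists>u\<in>gauss_units. a = u * a' \<and> b = u * b' \<and> c = u * c'"
  then obtain u where "u \<in> gauss_units" "a = u * a' \<and> b = u * b' \<and> c = u * c'" by blast
  then have "cubic 0 a b c \<xi> = u * cubic 0 a' b' c' \<xi> + 0" "u \<in> gauss_units"
    by (simp_all add: cubic_scale)
  then show "rel_equivalent (cubic 0 a b c \<xi>) (cubic 0 a' b' c' \<xi>)"
    unfolding rel_equivalent_def by blast
qed

text \<open>Units have absolute value 1, while the possible last coordinates 0, 1, 2\<i> have
  distinct absolute values; hence these agree. If nonzero they force the unit to be 1, and only one
  triple ends in 0.\<close>

lemma generator_coords_inequivalent:
  assumes "(a, b, c) \<in> generator_coords" "(a', b', c') \<in> generator_coords"
    and "rel_equivalent (cubic 0 a b c \<xi>) (cubic 0 a' b' c' \<xi>)"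
  shows "(a, b, c) = (a', b', c')"
proof -
  obtain u where u: "u \<in> {1, -1, \<i>, -\<i>}" "a = u * a'" "b = u * b'" "c = u * c'"
    using assms(3) rel_equivalent_cubic[OF generator_coords_gauss_ints[OF assms(1)]
        generator_coords_gauss_ints[OF assms(2)]] unfolding gauss_units_eq by blast
  have mem: "c \<in> {0, 1, 2 * \<i>} \<and> (c = 0 \<longrightarrow> a = 1 \<and> b = 0)" if "(a, b, c) \<in> generator_coords" for a b c
    using that unfolding generator_coords_def by (auto split: if_splits)
  have "cmod c = cmod c'" using u(1,4) by (auto simp: norm_mult)
  then have c: "c = c'" using mem[OF assms(1)] mem[OF assms(2)] by (auto simp: norm_mult)
  show ?thesis
  proof (cases "c = 0")
    case True
    then show ?thesis using c mem[OF assms(1)] mem[OF assms(2)] by simp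
  next
    case False
    then have "u = 1" using u(4) c by simp
    then show ?thesis using u by simp
  qed
qed

lemma generates_iff:
  assumes xyz: "x \<in> gauss_ints" "y \<in> gauss_ints" "z \<in> gauss_ints" and bound: "cmod y \<le> 30"
  shows "generates_rel_pib OK (cubic 0 x y z \<xi>) \<longleftrightarrow>
    (\<exists>(a, b, c)\<in>generator_coords. rel_equivalent (cubic 0 x y z \<xi>) (cubic 0 a b c \<xi>))"
proof
  assume "generates_rel_pib OK (cubic 0 x y z \<xi>)"
  then have "\<xi> \<in> adjoin_ring gauss_ints (cubic 0 x y z \<xi>)"
    using OK_\<xi> unfolding generates_rel_pib_def by simp
  from index_form_units_imp[OF xyz bound generator_index_form_units[OF xyz this]]
  obtain u where u: "u \<in> gauss_units" and
    "(x = u \<and> y = 0 \<and> z = 0) \<or> (x = u * (- s) \<and> y = 0 \<and> z = u) \<or>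
      t = 1 \<and> (\<exists>h\<in>{1 + \<i>, - (1 + \<i>)}. (x = u * 3 \<and> y = u * h \<and> z = u * (2 * \<i>)) \<or>
        (x = u * \<i> \<and> y = u * h \<and> z = u))" by blast
  then have "\<exists>(a, b, c)\<in>generator_coords. x = u * a \<and> y = u * b \<and> z = u * c"
    unfolding generator_coords_def by auto
  then obtain a b c where abc: "(a, b, c) \<in> generator_coords" "x = u * a \<and> y = u * b \<and> z = u * c" by blast
  then have "rel_equivalent (cubic 0 x y z \<xi>) (cubic 0 a b c \<xi>)"
    using rel_equivalent_cubic[OF xyz generator_coords_gauss_ints[OF abc(1)]] u by blast
  then show "\<exists>(a, b, c)\<in>generator_coords. rel_equivalent (cubic 0 x y z \<xi>) (cubic 0 a b c \<xi>)"
    using abc(1) by blast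
next
  assume "\<exists>(a, b, c)\<in>generator_coords. rel_equivalent (cubic 0 x y z \<xi>) (cubic 0 a b c \<xi>)"
  then obtain a b c where "(a, b, c) \<in> generator_coords"
    and "rel_equivalent (cubic 0 x y z \<xi>) (cubic 0 a b c \<xi>)" by blast
  then show "generates_rel_pib OK (cubic 0 x y z \<xi>)"
    using generator_coords_generate adjoin_gauss_ints_affine unfolding generates_rel_pib_def by simp
qed

end

theorem theorem4:
  fixes t :: nat and \<xi> :: complex
  assumes "t > 0" and "t \<le> 100" and "squarefree (t ^ 2 + 4)"
    and "poly (quartic t) \<xi> = 0"
  shows "irreducible_over gauss_rats (quartic t) \<and>
    (let OK = ring_of_integers (adjoin_field gauss_rats \<xi>);
         L = {\<xi>, - \<i> * of_nat t * \<xi> + \<xi> ^ 3} \<union>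
             (if t = 1
              then {3 * \<xi> + (1 + \<i>) * \<xi> ^ 2 + 2 * \<i> * \<xi> ^ 3,
                    3 * \<xi> - (1 + \<i>) * \<xi> ^ 2 + 2 * \<i> * \<xi> ^ 3,
                    \<i> * \<xi> + (1 + \<i>) * \<xi> ^ 2 + \<xi> ^ 3,
                    \<i> * \<xi> - (1 + \<i>) * \<xi> ^ 2 + \<xi> ^ 3}
              else {})
     in (\<forall>\<beta>\<in>L. generates_rel_pib OK \<beta>) \<and>
        (\<forall>\<beta>\<in>L. \<forall>\<gamma>\<in>L. rel_equivalent \<beta> \<gamma> \<longrightarrow> \<beta> = \<gamma>) \<and>
        (\<forall>x\<in>gauss_ints. \<forall>y\<in>gauss_ints. \<forall>z\<in>gauss_ints.
           max (cmod x) (max (cmod y) (cmod z)) \<le> 30 \<longrightarrow>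
           (generates_rel_pib OK (x * \<xi> + y * \<xi> ^ 2 + z * \<xi> ^ 3) \<longleftrightarrow>
            (\<exists>\<beta>\<in>L. rel_equivalent (x * \<xi> + y * \<xi> ^ 2 + z * \<xi> ^ 3) \<beta>))))"
proof -
  interpret quartic_root t \<xi>
  proof
    show "squarefree (t\<^sup>2 + 4)" by fact
    have "poly (quartic t) \<xi> = 1 - \<i> * of_nat t * \<xi>\<^sup>2 + \<xi> ^ 4"
      by (simp add: quartic_def power2_eq_square power4_eq_xxxx algebra_simps)
    then show "\<xi> ^ 4 = \<i> * of_nat t * \<xi>\<^sup>2 - 1"
      using assms(4) by (simp add: algebra_simps eq_neg_iff_add_eq_0)
  qed
  define g where "g = (\<lambda>(a, b, c). cubic 0 a b c \<xi>)"
  define L where "L = {\<xi>, - \<i> * of_nat t * \<xi> + \<xi> ^ 3} \<union>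
             (if t = 1
              then {3 * \<xi> + (1 + \<i>) * \<xi> ^ 2 + 2 * \<i> * \<xi> ^ 3,
                    3 * \<xi> - (1 + \<i>) * \<xi> ^ 2 + 2 * \<i> * \<xi> ^ 3,
                    \<i> * \<xi> + (1 + \<i>) * \<xi> ^ 2 + \<xi> ^ 3,
                    \<i> * \<xi> - (1 + \<i>) * \<xi> ^ 2 + \<xi> ^ 3}
              else {})"
  \<comment> \<open>With the list given as a table of coordinates, generation and equivalence are
    decided on triples.\<close>
  have L: "L = g ` generator_coords"
  proof -
    have "g (1, 0, 0) = \<xi>" "g (- s, 0, 1) = - \<i> * of_nat t * \<xi> + \<xi> ^ 3"
      "g (3, 1 + \<i>, 2 * \<i>) = 3 * \<xi> + (1 + \<i>) * \<xi> ^ 2 + 2 * \<i> * \<xi> ^ 3"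
      "g (3, - (1 + \<i>), 2 * \<i>) = 3 * \<xi> - (1 + \<i>) * \<xi> ^ 2 + 2 * \<i> * \<xi> ^ 3"
      "g (\<i>, 1 + \<i>, 1) = \<i> * \<xi> + (1 + \<i>) * \<xi> ^ 2 + \<xi> ^ 3"
      "g (\<i>, - (1 + \<i>), 1) = \<i> * \<xi> - (1 + \<i>) * \<xi> ^ 2 + \<xi> ^ 3"
      by (simp_all add: g_def cubic_def s_def algebra_simps)
    then show ?thesis unfolding L_def generator_coords_def by (simp only: image_Un image_insert image_empty split: if_split) simp
  qed
  have "\<forall>\<beta>\<in>L. generates_rel_pib OK \<beta>"
    unfolding L g_def using generator_coords_generate by auto
  moreover have "\<forall>\<beta>\<in>L. \<forall>\<gamma>\<in>L. rel_equivalent \<beta> \<gamma> \<longrightarrow> \<beta> = \<gamma>"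
    unfolding L g_def using generator_coords_inequivalent by fastforce
  moreover have "generates_rel_pib OK (x * \<xi> + y * \<xi> ^ 2 + z * \<xi> ^ 3) \<longleftrightarrow>
      (\<exists>\<beta>\<in>L. rel_equivalent (x * \<xi> + y * \<xi> ^ 2 + z * \<xi> ^ 3) \<beta>)"
    if "x \<in> gauss_ints" "y \<in> gauss_ints" "z \<in> gauss_ints" "max (cmod x) (max (cmod y) (cmod z)) \<le> 30"
    for x y z
  proof -
    have "x * \<xi> + y * \<xi> ^ 2 + z * \<xi> ^ 3 = cubic 0 x y z \<xi>" by (simp add: cubic_def)
    then show ?thesis using generates_iff[OF that(1-3)] that(4) unfolding L g_def by (simp add: case_prod_beta)
  qed
  ultimately show ?thesis
    using irreducible_quartic unfolding ring_of_integers_eq Let_def L_def[symmetric] by blast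
qed

end
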